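(* Let $\mathcal{G}$ be a hereditary class of graphs. The parameters $\mathrm{tree}\text{-}\alpha$ and $\mathrm{tree}\text{-}\mu$ are functionally equivalent in $\mathcal{G}$ if and only if $\mathcal{G}$ does not contain all complete bipartite graphs.
   Context: All graphs are finite, simple, undirected, and have at least one vertex. A graph class is a class of graphs closed under isomorphism; it is hereditary if it is closed under vertex deletion (equivalently, under taking induced subgraphs). Two graph parameters $p$ and $q$ (with values in the nonnegative integers) are functionally equivalent in $\mathcal{G}$ if each can be bounded by a function of the other on $\mathcal{G}$, i.e., there exist functions $f,g$ from nonnegative integers to nonnegative integers such that $p(G)\leq f(q(G))$ and $q(G)\leq g(p(G))$ for every $G\in\mathcal{G}$. For $X\subseteq V(G)$, $\alpha(X)$ denotes the maximum size of an independent set of $G$ contained in $X$. A tree decomposition of a graph $G$ is a pair $\mathcal{T}=(T,\beta)$ where $T$ is a tree and $\beta$ maps each node $x$ of $T$ to a set $\beta(x)\subseteq V(G)$ (a bag) such that: (1) every vertex of $G$ belongs to some bag; (2) for every edge $uv$ of $G$, some bag contains both $u$ and $v$; (3) for every vertex $v$ of $G$, the set $\{x\in V(T)\mid v\in\beta(x)\}$ induces a connected subgraph of $T$. An induced matching in $G$ is a set $M$ of pairwise disjoint edges of $G$ such that no vertex of one edge of $M$ is adjacent in $G$ to a vertex of a different edge of $M$. An induced matching $M$ touches a set $X\subseteq V(G)$ if every edge of $M$ has at least one endpoint in $X$. For a tree decomposition $\mathcal{T}=(T,\beta)$ of $G$: $\alpha(\mathcal{T})=\max_{x\in V(T)}\alpha(\beta(x))$,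 and $\mu(\mathcal{T})$ is the maximum, over $x\in V(T)$, of the maximum size of an induced matching in $G$ that touches $\beta(x)$. The tree-independence number $\mathrm{tree}\text{-}\alpha(G)$ is the minimum of $\alpha(\mathcal{T})$, and the induced matching treewidth $\mathrm{tree}\text{-}\mu(G)$ is the minimum of $\mu(\mathcal{T})$, over all tree decompositions $\mathcal{T}$ of $G$. *)

theory Defs
  imports "HOL-Library.Ramsey" "HOL-Library.Infinite_Typeclass"
begin

section \<open>Finite simple graphs\<close>

text \<open>Edges are two-element sets of vertices, so that \<^const>\<open>indep\<close> from
  \<^theory>\<open>HOL-Library.Ramsey\<close> applies to edge sets directly.\<close>

record 'a ugraph =
  verts :: "'a set"
  edges :: "'a set set"

definition simple_graph :: "'a ugraph \<Rightarrow> bool" where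
  "simple_graph G \<longleftrightarrow> finite (verts G) \<and> verts G \<noteq> {} \<and> edges G \<subseteq> [verts G]\<^bsup>2\<^esup>"

definition graph_iso :: "'a ugraph \<Rightarrow> 'b ugraph \<Rightarrow> bool" where
  "graph_iso G H \<longleftrightarrow> (\<exists>f. bij_betw f (verts G) (verts H) \<and>
     (\<forall>u\<in>verts G. \<forall>v\<in>verts G. {u, v} \<in> edges G \<longleftrightarrow> {f u, f v} \<in> edges H))"

definition induced_subgraph :: "'a ugraph \<Rightarrow> 'a set \<Rightarrow> 'a ugraph" where
  "induced_subgraph G X = \<lparr>verts = X, edges = {e \<in> edges G. e \<subseteq> X}\<rparr>"

definition del_vertex :: "'a ugraph \<Rightarrow> 'a \<Rightarrow> 'a ugraph" where
  "del_vertex G v = induced_subgraph G (verts G - {v})"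

text \<open>Both sides are required to be nonempty. For hereditary classes this does not affect
  whether all complete bipartite graphs belong to the class.\<close>

definition complete_bipartite :: "'a ugraph \<Rightarrow> bool" where
  "complete_bipartite G \<longleftrightarrow> simple_graph G \<and>
     (\<exists>A B. A \<noteq> {} \<and> B \<noteq> {} \<and> A \<inter> B = {} \<and> verts G = A \<union> B \<and>
        edges G = {{a, b} | a b. a \<in> A \<and> b \<in> B})"

section \<open>Graph classes\<close>

text \<open>A class is represented by its members with vertices in the type \<^typ>\<open>'a\<close>. If this type
  is infinite, every finite graph has an isomorphic copy there, so nothing is lost.\<close>

definition graph_class :: "'a ugraph set \<Rightarrow> bool" where
  "graph_class \<G> \<longleftrightarrow> (\<forall>G\<in>\<G>. simple_graph G) \<and>
     (\<forall>G\<in>\<G>. \<forall>H. simple_graph H \<and> graph_iso G H \<longrightarrow> H \<in> \<G>)"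

text \<open>Graphs have at least one vertex, hence the last vertex is never deleted.\<close>

definition hereditary :: "'a ugraph set \<Rightarrow> bool" where
  "hereditary \<G> \<longleftrightarrow>
     (\<forall>G\<in>\<G>. \<forall>v\<in>verts G. verts G \<noteq> {v} \<longrightarrow> del_vertex G v \<in> \<G>)"

definition functionally_equivalent ::
    "('a ugraph \<Rightarrow> nat) \<Rightarrow> ('a ugraph \<Rightarrow> nat) \<Rightarrow> 'a ugraph set \<Rightarrow> bool" where
  "functionally_equivalent p q \<G> \<longleftrightarrow>
     (\<exists>f g :: nat \<Rightarrow> nat. \<forall>G\<in>\<G>. p G \<le> f (q G) \<and> q G \<le> g (p G))"

section \<open>Tree decompositions\<close>

definition connected_graph :: "'a ugraph \<Rightarrow> bool" where
  "connected_graph G \<longleftrightarrow> (\<forall>u\<in>verts G. \<forall>v\<in>verts G. (u, v) \<in> {(x, y). {x, y} \<in> edges G}\<^sup>*)"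

definition is_cycle :: "'a ugraph \<Rightarrow> 'a list \<Rightarrow> bool" where
  "is_cycle G xs \<longleftrightarrow> 3 \<le> length xs \<and> distinct xs \<and> set xs \<subseteq> verts G \<and>
     (\<forall>i<length xs. {xs ! i, xs ! (Suc i mod length xs)} \<in> edges G)"

definition is_tree :: "'a ugraph \<Rightarrow> bool" where
  "is_tree T \<longleftrightarrow> simple_graph T \<and> connected_graph T \<and> (\<nexists>xs. is_cycle T xs)"

text \<open>Up to isomorphism every finite tree has its nodes in \<^typ>\<open>nat\<close>.\<close>

definition tree_decomposition :: "'a ugraph \<Rightarrow> nat ugraph \<Rightarrow> (nat \<Rightarrow> 'a set) \<Rightarrow> bool" where
  "tree_decomposition G T \<beta> \<longleftrightarrow> is_tree T \<and>
     (\<forall>x\<in>verts T. \<beta> x \<subseteq> verts G) \<and>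
     (\<forall>v\<in>verts G. \<exists>x\<in>verts T. v \<in> \<beta> x) \<and>
     (\<forall>e\<in>edges G. \<exists>x\<in>verts T. e \<subseteq> \<beta> x) \<and>
     (\<forall>v\<in>verts G. connected_graph (induced_subgraph T {x \<in> verts T. v \<in> \<beta> x}))"

section \<open>Tree-independence number and induced matching treewidth\<close>

definition alpha :: "'a ugraph \<Rightarrow> 'a set \<Rightarrow> nat" where
  "alpha G X = Max {card S | S. S \<subseteq> X \<and> indep S (edges G)}"

definition induced_matching :: "'a ugraph \<Rightarrow> 'a set set \<Rightarrow> bool" where
  "induced_matching G M \<longleftrightarrow> M \<subseteq> edges G \<and>
     (\<forall>e\<in>M. \<forall>f\<in>M. e \<noteq> f \<longrightarrow> e \<inter> f = {} \<and> (\<forall>u\<in>e. \<forall>v\<in>f. {u, v} \<notin> edges G))"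

definition touches :: "'a set set \<Rightarrow> 'a set \<Rightarrow> bool" where
  "touches M X \<longleftrightarrow> (\<forall>e\<in>M. e \<inter> X \<noteq> {})"

definition mu :: "'a ugraph \<Rightarrow> 'a set \<Rightarrow> nat" where
  "mu G X = Max {card M | M. induced_matching G M \<and> touches M X}"

definition decomp_alpha :: "'a ugraph \<Rightarrow> nat ugraph \<Rightarrow> (nat \<Rightarrow> 'a set) \<Rightarrow> nat" where
  "decomp_alpha G T \<beta> = (MAX x\<in>verts T. alpha G (\<beta> x))"

definition decomp_mu :: "'a ugraph \<Rightarrow> nat ugraph \<Rightarrow> (nat \<Rightarrow> 'a set) \<Rightarrow> nat" where
  "decomp_mu G T \<beta> = (MAX x\<in>verts T. mu G (\<beta> x))"

text \<open>The infima below are minima: every graph has the tree decomposition with a single bag.\<close>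

definition tree_alpha :: "'a ugraph \<Rightarrow> nat" where
  "tree_alpha G = Inf {decomp_alpha G T \<beta> | T \<beta>. tree_decomposition G T \<beta>}"

definition tree_mu :: "'a ugraph \<Rightarrow> nat" where
  "tree_mu G = Inf {decomp_mu G T \<beta> | T \<beta>. tree_decomposition G T \<beta>}"

end

theory Submission
  imports Defs
begin

text \<open>Let \<open>G\<close> contain no induced biclique with sides of size \<open>n\<close>, and take a tree decomposition whose
  bags touch only induced matchings of size at most \<open>k\<close>. Call a vertex low if its neighbourhood
  contains no independent set of size \<open>c\<close>, and let \<open>I\<close> be a maximal independent set of low vertices.
  Replace every bag \<open>X\<close> by \<open>(X - I) \<union> N(X \<inter> I)\<close> and attach a leaf with bag \<open>{v} \<union> N(v)\<close> for every
  \<open>v \<in> I\<close>. The new bags have bounded independence number. An independent set of high vertices in \<open>X\<close>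
  is bounded, because large independent neighbourhoods yield an induced matching in the absence of
  bicliques. Independent sets in \<open>N(X \<inter> I)\<close>, and those of low vertices in \<open>X - I\<close>, are dominated by \<open>I\<close>;
  a minimal dominating subset of \<open>I\<close> has at least a \<open>1/c\<close> fraction of their size, and with private
  neighbours it forms an induced matching touching \<open>X\<close>.\<close>

section \<open>Induced matchings in graphs without large bicliques\<close>

text \<open>An induced \<open>K_{n,n}\<close> is excluded. In a simple graph the two sides are
  automatically disjoint, since a common vertex would be adjacent to itself. Only the edge set
  enters, because the induction below keeps the edges and shrinks the vertex sets.\<close>

definition biclique_free :: "nat \<Rightarrow> 'a set set \<Rightarrow> bool" where
  "biclique_free n E \<longleftrightarrow> (\<nexists>A B. finite A \<and> finite B \<and> card A = n \<and> card B = n \<and>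
     indep A E \<and> indep B E \<and> (\<forall>a\<in>A. \<forall>b\<in>B. {a, b} \<in> E))"

text \<open>If \<open>n\<close> vertices of \<open>A\<close> each missed fewer than \<open>s\<close>
  vertices of \<open>B\<close>, together they would miss at most \<open>n * s\<close>, and
  \<open>n\<close> of the remaining vertices of \<open>B\<close> would complete a forbidden
  biclique.\<close>

lemma few_almost_complete:
  assumes free: "biclique_free n E" and A: "finite A" "indep A E" and B: "finite B" "indep B E"
    and large: "n * s + n \<le> card B"
  shows "card {a \<in> A. card {b \<in> B. {a, b} \<notin> E} < s} < n"
proof (rule ccontr)
  assume "\<not> ?thesis"
  then have "n \<le> card {a \<in> A. card {b \<in> B. {a, b} \<notin> E} < s}"
    by simp
  then obtain A' where A': "A' \<subseteq> {a \<in> A. card {b \<in> B. {a, b} \<notin> E} < s}" "card A' = n" "finite A'"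
    by (rule obtain_subset_with_card_n)
  define B' where "B' = {b \<in> B. \<forall>a\<in>A'. {a, b} \<in> E}"
  have "B - B' = (\<Union>a\<in>A'. {b \<in> B. {a, b} \<notin> E})"
    by (auto simp: B'_def)
  then have "card (B - B') \<le> (\<Sum>a\<in>A'. card {b \<in> B. {a, b} \<notin> E})"
    using card_UN_le[OF A'(3)] by simp
  also have "\<dots> \<le> (\<Sum>a\<in>A'. s)"
    using A'(1) by (intro sum_mono) (auto simp: subset_iff)
  finally have "card (B - B') \<le> n * s"
    using A'(2) by simp
  moreover have "card B' = card B - card (B - B')"
  proof -
    have "B' \<subseteq> B" by (auto simp: B'_def)
    then have "card (B - B') = card B - card B'" "card B' \<le> card B"
      using B(1) by (auto intro: card_Diff_subset card_mono finite_subset)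
    then show ?thesis by simp
  qed
  ultimately have "n \<le> card B'"
    using large by linarith
  then obtain C where C: "C \<subseteq> B'" "card C = n" "finite C"
    by (rule obtain_subset_with_card_n)
  have "indep A' E" "indep C E"
    using smaller_indep[OF A(2), of A'] smaller_indep[OF B(2), of C] A'(1) C(1) by (auto simp: B'_def)
  moreover have "\<forall>a\<in>A'. \<forall>b\<in>C. {a, b} \<in> E"
    using C(1) by (auto simp: B'_def)
  ultimately have "\<exists>A B. finite A \<and> finite B \<and> card A = n \<and> card B = n \<and>
     indep A E \<and> indep B E \<and> (\<forall>a\<in>A. \<forall>b\<in>B. {a, b} \<in> E)"
    using A'(2,3) C(2,3) by (intro exI[of _ A'] exI[of _ C] conjI)
  then show False
    using free unfolding biclique_free_def by (rule notE[rotated])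
qed

text \<open>Pigeonhole: the at most \<open>n\<close> fibres over \<open>V\<close> cover
  \<open>W\<close>, so not all of them can have size at most \<open>N\<close>.\<close>

lemma common_large_fibre:
  assumes "finite W" "finite V" "card V \<le> n" "n * N < card W"
    and "\<And>w. w \<in> W \<Longrightarrow> \<exists>v\<in>V. R v w"
  shows "\<exists>v\<in>V. N < card {w \<in> W. R v w}"
proof (rule ccontr)
  assume "\<not> ?thesis"
  then have le: "card {w \<in> W. R v w} \<le> N" if "v \<in> V" for v
    using that by (meson not_less)
  have "W \<subseteq> (\<Union>v\<in>V. {w \<in> W. R v w})"
    using assms(5) by auto
  then have "card W \<le> card (\<Union>v\<in>V. {w \<in> W. R v w})"
    using assms(1,2) by (intro card_mono) auto
  also have "\<dots> \<le> (\<Sum>v\<in>V. card {w \<in> W. R v w})"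
    using assms(2) by (rule card_UN_le)
  also have "\<dots> \<le> (\<Sum>v\<in>V. N)"
    using le by (rule sum_mono)
  also have "\<dots> \<le> n * N"
    using assms(3) by simp
  finally show False
    using assms(4) by simp
qed

text \<open>Induction on \<open>p\<close>: one matching edge \<open>v\<close>, \<open>a\<close> is
  chosen so that enough other vertices keep large neighbourhoods avoiding both ends. The sets
  \<open>A v\<close> are arbitrary independent sets of neighbours so that the induction can shrink
  them. \<open>N\<close> and \<open>c\<close> are chosen before the graph and depend only on
  \<open>n\<close> and \<open>p\<close>.\<close>

lemma induced_matching_of_large_neighbourhoods:
  assumes "0 < n"
  shows "\<exists>N c. \<forall>(E :: 'a set set) V A. biclique_free n E \<longrightarrow> finite V \<longrightarrow> indep V E \<longrightarrow> N \<le> card V \<longrightarrow>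
     (\<forall>v\<in>V. finite (A v) \<and> indep (A v) E \<and> c \<le> card (A v) \<and> (\<forall>a\<in>A v. {v, a} \<in> E)) \<longrightarrow>
     (\<exists>M f. M \<subseteq> V \<and> card M = p \<and>
        (\<forall>v\<in>M. f v \<in> A v \<and> (\<forall>w\<in>M. v \<noteq> w \<longrightarrow> {v, f w} \<notin> E \<and> {f v, f w} \<notin> E)))"
proof (induction p)
  case 0
  show ?case
    by (intro exI[of _ 0] allI impI exI[of _ "{}"]) auto
next
  case (Suc p)
  then obtain N c where IH: "\<And>(E :: 'a set set) V A. biclique_free n E \<Longrightarrow> finite V \<Longrightarrow> indep V E \<Longrightarrow>
     N \<le> card V \<Longrightarrow>
     (\<forall>v\<in>V. finite (A v) \<and> indep (A v) E \<and> c \<le> card (A v) \<and> (\<forall>a\<in>A v. {v, a} \<in> E)) \<Longrightarrow>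
     (\<exists>M f. M \<subseteq> V \<and> card M = p \<and>
        (\<forall>v\<in>M. f v \<in> A v \<and> (\<forall>w\<in>M. v \<noteq> w \<longrightarrow> {v, f w} \<notin> E \<and> {f v, f w} \<notin> E)))"
    by blast
  \<comment> \<open>\<open>N1\<close> and \<open>c1\<close> are the sizes required after the choice
    of \<open>v\<close>, and \<open>N\<close> and \<open>c\<close> those required after the choice
    of \<open>a\<close>. Their form is the size hypothesis of \<open>few_almost_complete\<close>
    with \<open>s = N\<close> and \<open>s = c\<close>.\<close>
  define N1 where "N1 = n * N + n"
  define c1 where "c1 = n * c + n"
  \<comment> \<open>\<open>N2\<close> leaves more than \<open>n * N1\<close> vertices once
    \<open>n\<close> candidates for \<open>v\<close> are set aside. In \<open>c2\<close>, the part
    \<open>n * c1 + n\<close> serves to find \<open>v\<close>, and the rest guarantees a vertex of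
    \<open>A v\<close> outside the bad sets.\<close>
  define N2 where "N2 = n * N1 + n + 1"
  define c2 where "c2 = n * c1 + n + n * N1 + n"
  have step: "\<exists>M f. M \<subseteq> V \<and> card M = Suc p \<and>
        (\<forall>v\<in>M. f v \<in> A v \<and> (\<forall>w\<in>M. v \<noteq> w \<longrightarrow> {v, f w} \<notin> E \<and> {f v, f w} \<notin> E))"
    if free: "biclique_free n E" and V: "finite V" "indep V E" "N2 \<le> card V"
      and A: "\<And>v. v \<in> V \<Longrightarrow> finite (A v)" "\<And>v. v \<in> V \<Longrightarrow> indep (A v) E"
        "\<And>v. v \<in> V \<Longrightarrow> c2 \<le> card (A v)" "\<And>v a. v \<in> V \<Longrightarrow> a \<in> A v \<Longrightarrow> {v, a} \<in> E"
    for E :: "'a set set" and V A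
  proof -
    have "n \<le> card V"
      using V(3) by (simp add: N2_def)
    then obtain V0 where V0: "V0 \<subseteq> V" "card V0 = n" "finite V0"
      by (rule obtain_subset_with_card_n)
    define W where "W = V - V0"
    have "card W = card V - n"
      unfolding W_def using V0 by (simp add: card_Diff_subset)
    then have cW: "n * N1 < card W"
      using V(3) by (simp add: N2_def)
    define A1 where "A1 v w = {a \<in> A w. {v, a} \<notin> E}" for v w
    \<comment> \<open>Otherwise all \<open>n\<close> candidates would be almost complete to
      \<open>A w\<close>, against \<open>few_almost_complete\<close>.\<close>
    have good: "\<exists>v\<in>V0. c1 \<le> card (A1 v w)" if "w \<in> W" for w
    proof (rule ccontr)
      assume "\<not> ?thesis"
      then have "{v \<in> V0. card {a \<in> A w. {v, a} \<notin> E} < c1} = V0"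
        by (auto simp: A1_def not_le)
      moreover have "card {v \<in> V0. card {a \<in> A w. {v, a} \<notin> E} < c1} < n"
      proof (rule few_almost_complete[OF free])
        show "n * c1 + n \<le> card (A w)"
          using A(3)[of w] that by (simp add: c2_def W_def)
      qed (use V0 V that A in \<open>auto simp: W_def intro: smaller_indep\<close>)
      ultimately show False
        using V0(2) by simp
    qed
    \<comment> \<open>One candidate works for more than \<open>N1\<close> vertices \<open>w\<close>.
      Exactly \<open>N1\<close> of them are kept, which bounds the number of sets
      \<open>bad w\<close>.\<close>
    then obtain v where v: "v \<in> V0" "N1 < card {w \<in> W. c1 \<le> card (A1 v w)}"
      using common_large_fibre[of W V0 n N1 "\<lambda>v w. c1 \<le> card (A1 v w)"] V0 cW V(1)
      by (auto simp: W_def)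
    then obtain W1 where W1: "W1 \<subseteq> {w \<in> W. c1 \<le> card (A1 v w)}" "card W1 = N1" "finite W1"
      by (meson less_imp_le obtain_subset_with_card_n)
    have vV: "v \<in> V"
      using v V0 by auto
    have W1V: "W1 \<subseteq> V - {v}"
      using W1(1) v(1) by (auto simp: W_def)
    \<comment> \<open>The partner \<open>a\<close> of \<open>v\<close> should miss at least
      \<open>N\<close> vertices of \<open>W1\<close>, and at least \<open>c\<close> vertices of
      \<open>A1 v w\<close> for each \<open>w\<close> in \<open>W1\<close>. \<open>bad0\<close> and
      the sets \<open>bad w\<close> collect the violators, fewer than \<open>n\<close> in
      each.\<close>
    define bad0 where "bad0 = {a \<in> A v. card {w \<in> W1. {a, w} \<notin> E} < N}"
    define bad where "bad w = {a \<in> A v. card {b \<in> A1 v w. {a, b} \<notin> E} < c}" for w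
    have "card bad0 < n"
      unfolding bad0_def
      by (rule few_almost_complete[OF free])
        (use A vV W1 W1V V in \<open>auto simp: N1_def intro: smaller_indep\<close>)
    moreover have "card (bad w) < n" if "w \<in> W1" for w
      unfolding bad_def
    proof (rule few_almost_complete[OF free])
      have "w \<in> V" using that W1V by auto
      then show "finite (A1 v w)" "indep (A1 v w) E"
        using A(1,2)[of w] by (auto simp: A1_def intro: smaller_indep)
      show "n * c + n \<le> card (A1 v w)"
        using that W1(1) by (auto simp: c1_def)
    qed (use A vV in auto)
    then have "card (\<Union>w\<in>W1. bad w) \<le> n * N1"
    proof -
      assume *: "\<And>w. w \<in> W1 \<Longrightarrow> card (bad w) < n"
      have "card (\<Union>w\<in>W1. bad w) \<le> (\<Sum>w\<in>W1. card (bad w))"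
        using W1(3) by (rule card_UN_le)
      also have "\<dots> \<le> (\<Sum>w\<in>W1. n)"
        using * by (intro sum_mono) (simp add: less_imp_le)
      finally show ?thesis
        using W1(2) by (simp add: mult.commute)
    qed
    ultimately have "card (bad0 \<union> (\<Union>w\<in>W1. bad w)) < card (A v)"
      using card_Un_le[of bad0 "\<Union>w\<in>W1. bad w"] A(3)[OF vV] assms by (simp add: c2_def)
    moreover have "finite (bad0 \<union> (\<Union>w\<in>W1. bad w))"
      using A(1)[OF vV] by (rule finite_subset[rotated]) (auto simp: bad0_def bad_def)
    ultimately have "\<not> A v \<subseteq> bad0 \<union> (\<Union>w\<in>W1. bad w)"
      by (metis card_mono not_less)
    then obtain a where a: "a \<in> A v" "a \<notin> bad0" "\<And>w. w \<in> W1 \<Longrightarrow> a \<notin> bad w"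
      by blast
    \<comment> \<open>What remains avoids the neighbours of \<open>a\<close>, and the sets
      \<open>A2 w\<close> also avoid those of \<open>v\<close>. Hence a matching obtained here
      extends by \<open>v\<close> with partner \<open>a\<close>.\<close>
    define W2 where "W2 = {w \<in> W1. {a, w} \<notin> E}"
    define A2 where "A2 w = {b \<in> A1 v w. {a, b} \<notin> E}" for w
    have "\<exists>M f. M \<subseteq> W2 \<and> card M = p \<and>
        (\<forall>v\<in>M. f v \<in> A2 v \<and> (\<forall>w\<in>M. v \<noteq> w \<longrightarrow> {v, f w} \<notin> E \<and> {f v, f w} \<notin> E))"
    proof (rule IH[OF free])
      show "finite W2" "indep W2 E"
        using W1(3) W1V smaller_indep[OF V(2), of W2] by (auto simp: W2_def)
      show "N \<le> card W2"
        using a by (auto simp: W2_def bad0_def)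
      show "\<forall>v\<in>W2. finite (A2 v) \<and> indep (A2 v) E \<and> c \<le> card (A2 v) \<and> (\<forall>a\<in>A2 v. {v, a} \<in> E)"
      proof
        fix w assume "w \<in> W2"
        then have w: "w \<in> W1" "w \<in> V"
          using W1V by (auto simp: W2_def)
        then have "c \<le> card (A2 w)"
          using a(1) a(3)[of w] by (auto simp: A2_def bad_def)
        then show "finite (A2 w) \<and> indep (A2 w) E \<and> c \<le> card (A2 w) \<and> (\<forall>a\<in>A2 w. {w, a} \<in> E)"
          using A(1,2,4)[OF w(2)] by (auto simp: A2_def A1_def intro: smaller_indep)
      qed
    qed
    then obtain M f where M: "M \<subseteq> W2" "card M = p"
      and f: "\<And>v. v \<in> M \<Longrightarrow> f v \<in> A2 v"
      and ind: "\<And>v w. v \<in> M \<Longrightarrow> w \<in> M \<Longrightarrow> v \<noteq> w \<Longrightarrow> {v, f w} \<notin> E \<and> {f v, f w} \<notin> E"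
      by blast
    have vM: "v \<notin> M"
      using M(1) W1V by (auto simp: W2_def)
    have finM: "finite M"
      using M(1) W1(3) by (auto simp: W2_def intro: finite_subset)
    have M1: "{a, w} \<notin> E" "{w, a} \<notin> E" "{v, f w} \<notin> E" "{a, f w} \<notin> E" "{f w, a} \<notin> E" "f w \<in> A w"
      if "w \<in> M" for w
      using that M(1) f[OF that] by (auto simp: W2_def A2_def A1_def insert_commute)
    have "insert v M \<subseteq> V" "card (insert v M) = Suc p"
      using vV M W1V vM finM by (auto simp: W2_def)
    moreover have "\<forall>u\<in>insert v M. (f(v := a)) u \<in> A u \<and> (\<forall>w\<in>insert v M. u \<noteq> w \<longrightarrow>
        {u, (f(v := a)) w} \<notin> E \<and> {(f(v := a)) u, (f(v := a)) w} \<notin> E)"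
      using a(1) M1 ind vM by auto
    ultimately show ?thesis
      by blast
  qed
  show ?case
  proof (rule exI[of _ N2], rule exI[of _ c2], intro allI impI)
    fix E :: "'a set set" and V A
    assume V: "biclique_free n E" "finite V" "indep V E" "N2 \<le> card V"
      and A: "\<forall>v\<in>V. finite (A v) \<and> indep (A v) E \<and> c2 \<le> card (A v) \<and> (\<forall>a\<in>A v. {v, a} \<in> E)"
    show "\<exists>M f. M \<subseteq> V \<and> card M = Suc p \<and>
        (\<forall>v\<in>M. f v \<in> A v \<and> (\<forall>w\<in>M. v \<noteq> w \<longrightarrow> {v, f w} \<notin> E \<and> {f v, f w} \<notin> E))"
      by (rule step[OF V]) (simp_all add: A)
  qed
qed

text \<open>In an inclusion-minimal dominating set every vertex has a private neighbour.\<close>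
lemma private_neighbours:
  assumes "finite D" "finite J" and dom: "\<And>j. j \<in> J \<Longrightarrow> \<exists>d\<in>D. {d, j} \<in> E"
    and deg: "\<And>d. d \<in> D \<Longrightarrow> card {j \<in> J. {d, j} \<in> E} \<le> c"
  shows "\<exists>M f. M \<subseteq> D \<and> card J \<le> c * card M \<and>
     (\<forall>v\<in>M. f v \<in> J \<and> {v, f v} \<in> E \<and> (\<forall>w\<in>M. v \<noteq> w \<longrightarrow> {v, f w} \<notin> E))"
proof -
  define P where "P M \<longleftrightarrow> M \<subseteq> D \<and> (\<forall>j\<in>J. \<exists>d\<in>M. {d, j} \<in> E)" for M
  have "P D"
    using dom by (auto simp: P_def)
  then obtain M where M: "P M" and min: "\<And>M'. P M' \<Longrightarrow> card M \<le> card M'"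
    using ex_has_least_nat[of P D card] by metis
  have fin: "finite M"
    using M assms(1) by (auto simp: P_def intro: finite_subset)
  have "\<exists>j\<in>J. \<forall>d\<in>M. {d, j} \<in> E \<longrightarrow> d = v" if "v \<in> M" for v
  proof (rule ccontr)
    assume "\<not> ?thesis"
    then have "P (M - {v})"
      using M by (auto simp: P_def)
    then show False
      using min[of "M - {v}"] card_Diff1_less[OF fin that] by simp
  qed
  then obtain f where f: "\<And>v. v \<in> M \<Longrightarrow> f v \<in> J \<and> (\<forall>d\<in>M. {d, f v} \<in> E \<longrightarrow> d = v)"
    by metis
  have "J \<subseteq> (\<Union>d\<in>M. {j \<in> J. {d, j} \<in> E})"
    using M by (auto simp: P_def)
  then have "card J \<le> card (\<Union>d\<in>M. {j \<in> J. {d, j} \<in> E})"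
    using assms(2) fin by (intro card_mono) auto
  also have "\<dots> \<le> (\<Sum>d\<in>M. card {j \<in> J. {d, j} \<in> E})"
    using fin by (rule card_UN_le)
  also have "\<dots> \<le> (\<Sum>d\<in>M. c)"
    using deg M by (intro sum_mono) (auto simp: P_def)
  finally have "card J \<le> c * card M"
    by (simp add: mult.commute)
  moreover have "\<forall>v\<in>M. f v \<in> J \<and> {v, f v} \<in> E \<and> (\<forall>w\<in>M. v \<noteq> w \<longrightarrow> {v, f w} \<notin> E)"
  proof
    fix v assume "v \<in> M"
    moreover from this obtain d where "d \<in> M" "{d, f v} \<in> E"
      using f[of v] M unfolding P_def by blast
    ultimately show "f v \<in> J \<and> {v, f v} \<in> E \<and> (\<forall>w\<in>M. v \<noteq> w \<longrightarrow> {v, f w} \<notin> E)"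
      using f by metis
  qed
  moreover have "M \<subseteq> D"
    using M by (simp add: P_def)
  ultimately show ?thesis
    by (intro exI[of _ M] exI[of _ f] conjI)
qed

section \<open>Surgery on tree decompositions\<close>

text \<open>Connectivity of an induced subgraph in terms of the bare edge set, so that the edge set
  and the node set can be varied separately.\<close>

definition connected_on :: "'a set set \<Rightarrow> 'a set \<Rightarrow> bool" where
  "connected_on E S \<longleftrightarrow> (\<forall>u\<in>S. \<forall>v\<in>S. (u, v) \<in> {(x, y). {x, y} \<in> E \<and> {x, y} \<subseteq> S}\<^sup>*)"

lemma connected_graph_induced_subgraph:
  "connected_graph (induced_subgraph G S) \<longleftrightarrow> connected_on (edges G) S"
  by (simp add: connected_graph_def connected_on_def induced_subgraph_def)

lemma simple_graph_edgeD:
  assumes "simple_graph G" "{u, v} \<in> edges G"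
  shows "u \<in> verts G" "v \<in> verts G" "u \<noteq> v"
proof -
  have "{u, v} \<in> [verts G]\<^bsup>2\<^esup>"
    using assms unfolding simple_graph_def by blast
  then show "u \<in> verts G" "v \<in> verts G" "u \<noteq> v"
    by simp_all
qed

lemma simple_graph_edgeE:
  assumes "simple_graph G" "e \<in> edges G"
  obtains u v where "e = {u, v}" "u \<in> verts G" "v \<in> verts G" "u \<noteq> v"
proof -
  have "e \<in> [verts G]\<^bsup>2\<^esup>"
    using assms by (auto simp: simple_graph_def)
  then show thesis
    using that by (elim nsets2_E)
qed

lemma simple_graph_finite: "simple_graph G \<Longrightarrow> finite (verts G)"
  by (simp add: simple_graph_def)

lemma connected_graph_iff_connected_on:
  assumes "simple_graph G"
  shows "connected_graph G \<longleftrightarrow> connected_on (edges G) (verts G)"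
proof -
  have "{(x, y). {x, y} \<in> edges G} = {(x, y). {x, y} \<in> edges G \<and> {x, y} \<subseteq> verts G}"
    using simple_graph_edgeD[OF assms] by auto
  then show ?thesis
    by (simp add: connected_graph_def connected_on_def)
qed

lemma connected_onD:
  "connected_on E S \<Longrightarrow> u \<in> S \<Longrightarrow> v \<in> S \<Longrightarrow> (u, v) \<in> {(x, y). {x, y} \<in> E \<and> {x, y} \<subseteq> S}\<^sup>*"
  by (simp add: connected_on_def)

text \<open>Adjacency within \<open>S\<close> is symmetric, so any two vertices are joined by a walk
  through \<open>r\<close>.\<close>

lemma connected_onI_root:
  assumes "\<And>v. v \<in> S \<Longrightarrow> (r, v) \<in> {(x, y). {x, y} \<in> E \<and> {x, y} \<subseteq> S}\<^sup>*"
  shows "connected_on E S"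
  unfolding connected_on_def
proof (intro ballI)
  fix u v assume uv: "u \<in> S" "v \<in> S"
  let ?R = "{(x, y). {x, y} \<in> E \<and> {x, y} \<subseteq> S}"
  have "sym ?R"
    by (auto simp: sym_def insert_commute)
  then have "(u, r) \<in> ?R\<^sup>*"
    using assms[OF uv(1)] by (meson symD sym_rtrancl)
  then show "(u, v) \<in> ?R\<^sup>*"
    using assms[OF uv(2)] by (rule rtrancl_trans)
qed

lemma connected_rtrancl_mono:
  assumes "(u, v) \<in> {(x, y). {x, y} \<in> E \<and> {x, y} \<subseteq> S}\<^sup>*" "S \<subseteq> S'"
  shows "(u, v) \<in> {(x, y). {x, y} \<in> E \<and> {x, y} \<subseteq> S'}\<^sup>*"
proof -
  have "{(x, y). {x, y} \<in> E \<and> {x, y} \<subseteq> S}\<^sup>* \<subseteq> {(x, y). {x, y} \<in> E \<and> {x, y} \<subseteq> S'}\<^sup>*"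
    using assms(2) by (intro rtrancl_mono) auto
  then show ?thesis
    using assms(1) by blast
qed

lemma connected_on_mono_edges:
  assumes "connected_on E S" "E \<subseteq> E'"
  shows "connected_on E' S"
proof -
  have "{(x, y). {x, y} \<in> E \<and> {x, y} \<subseteq> S}\<^sup>* \<subseteq> {(x, y). {x, y} \<in> E' \<and> {x, y} \<subseteq> S}\<^sup>*"
    using assms(2) by (intro rtrancl_mono) auto
  then show ?thesis
    using assms(1) unfolding connected_on_def by blast
qed

lemma connected_on_singleton: "connected_on E {x}"
  by (simp add: connected_on_def)

text \<open>From a root in \<open>A\<close>, each \<open>B i\<close> is reached through a common
  vertex with \<open>A\<close>. This is needed for the nodes where a vertex occurs after the bags
  absorb neighbourhoods.\<close>

lemma connected_on_UN:
  assumes A: "connected_on E A" and B: "\<And>i. i \<in> I \<Longrightarrow> connected_on E (B i)"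
    and meet: "\<And>i. i \<in> I \<Longrightarrow> A \<inter> B i \<noteq> {}"
  shows "connected_on E (A \<union> (\<Union>i\<in>I. B i))"
proof (cases "A = {}")
  case True
  then have "A \<union> (\<Union>i\<in>I. B i) = {}"
    using meet by auto
  then show ?thesis
    by (simp add: connected_on_def)
next
  case False
  then obtain r where r: "r \<in> A"
    by auto
  let ?S = "A \<union> (\<Union>i\<in>I. B i)"
  let ?R = "{(x, y). {x, y} \<in> E \<and> {x, y} \<subseteq> ?S}"
  have inA: "(r, v) \<in> ?R\<^sup>*" if "v \<in> A" for v
    by (rule connected_rtrancl_mono[OF connected_onD[OF A r that]]) auto
  have "(r, v) \<in> ?R\<^sup>*" if i: "i \<in> I" and "v \<in> B i" for i v
  proof -
    obtain a where a: "a \<in> A" "a \<in> B i"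
      using meet[OF i] by auto
    have "(a, v) \<in> ?R\<^sup>*"
      by (rule connected_rtrancl_mono[OF connected_onD[OF B[OF i] a(2) that(2)]]) (use i in auto)
    then show ?thesis
      using inA[OF a(1)] by (meson rtrancl_trans)
  qed
  then show ?thesis
    using inA by (intro connected_onI_root) auto
qed

lemma connected_on_insert:
  assumes "connected_on E S" "x \<in> S" "{x, y} \<in> E"
  shows "connected_on E (insert y S)"
proof -
  have "connected_on E {x, y}"
    using assms(3) by (intro connected_onI_root[where r = x]) (auto simp: insert_commute)
  then have "connected_on E (S \<union> (\<Union>i\<in>{()}. {x, y}))"
    using assms by (intro connected_on_UN) auto
  moreover have "S \<union> (\<Union>i\<in>{()}. {x, y}) = insert y S"
    using assms(2) by auto
  ultimately show ?thesis
    by simp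
qed

text \<open>A walk enters and leaves \<open>l\<close> only through \<open>p\<close>. Replacing
  visits to \<open>l\<close> by \<open>p\<close> gives a walk that avoids \<open>l\<close>; the
  induction applies this replacement to the current endpoint.\<close>

lemma connected_on_delete_leaf:
  assumes conn: "connected_on E S" and leaf: "\<And>y. {l, y} \<in> E \<Longrightarrow> y = p"
    and p: "p \<noteq> l" "l \<in> S \<Longrightarrow> p \<in> S"
  shows "connected_on E (S - {l})"
  unfolding connected_on_def
proof (intro ballI)
  fix u v assume uv: "u \<in> S - {l}" "v \<in> S - {l}"
  let ?R = "{(x, y). {x, y} \<in> E \<and> {x, y} \<subseteq> S}"
  let ?R' = "{(x, y). {x, y} \<in> E \<and> {x, y} \<subseteq> S - {l}}"
  have "(u, w) \<in> ?R\<^sup>* \<Longrightarrow> (u, if w = l then p else w) \<in> ?R'\<^sup>*" for w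
  proof (induction rule: rtrancl_induct)
    case base
    then show ?case using uv by simp
  next
    case (step y z)
    have "{z, y} \<in> E" "{y, z} \<in> E"
      using step(2) by (auto simp: insert_commute)
    then have "y = l \<Longrightarrow> z = p" "z = l \<Longrightarrow> y = p"
      using leaf by auto
    then consider "y = l" "z = p" | "z = l" "y = p" | "y \<noteq> l" "z \<noteq> l"
      by blast
    then show ?case
    proof cases
      case 3
      then have "(y, z) \<in> ?R'"
        using step(2) by auto
      moreover have "(u, y) \<in> ?R'\<^sup>*"
        using step(3) 3 by simp
      ultimately show ?thesis
        using 3 by (simp add: rtrancl.rtrancl_into_rtrancl)
    qed (use step(3) p(1) in simp_all)
  qed
  from this[of v] show "(u, v) \<in> ?R'\<^sup>*"
    using connected_onD[OF conn] uv by auto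
qed

section \<open>Leaves of trees, and bicliques in tree decompositions\<close>

lemma is_cycle_induced_subgraph:
  "is_cycle (induced_subgraph G S) xs \<Longrightarrow> S \<subseteq> verts G \<Longrightarrow> is_cycle G xs"
  by (auto simp: is_cycle_def induced_subgraph_def)

lemma is_tree_simple: "is_tree T \<Longrightarrow> simple_graph T"
  by (simp add: is_tree_def)

text \<open>A neighbour of the end of a longest path lies on the path, and by acyclicity it is the
  neighbour along the path.\<close>
lemma tree_leaf:
  assumes T: "is_tree T" and two: "\<And>r. verts T \<noteq> {r}"
  obtains l p where "l \<in> verts T" "p \<in> verts T" "p \<noteq> l" "{l, p} \<in> edges T"
    "\<forall>y. {l, y} \<in> edges T \<longrightarrow> y = p"
proof -
  note simple = is_tree_simple[OF T]
  define P where "P xs \<longleftrightarrow> xs \<noteq> [] \<and> distinct xs \<and> set xs \<subseteq> verts T \<and>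
    (\<forall>i. Suc i < length xs \<longrightarrow> {xs ! i, xs ! Suc i} \<in> edges T)" for xs
  obtain r0 where "r0 \<in> verts T"
    using simple by (auto simp: simple_graph_def)
  then have "P [r0]"
    by (simp add: P_def)
  moreover have "length xs < Suc (card (verts T))" if "P xs" for xs
    using that simple_graph_finite[OF simple] unfolding P_def
    by (metis card_mono distinct_card le_imp_less_Suc)
  ultimately obtain xs where xs: "P xs" and max: "\<And>ys. P ys \<Longrightarrow> length ys \<le> length xs"
    using ex_has_greatest_nat[of P "[r0]" length "Suc (card (verts T))"] by (auto simp: less_imp_le)
  then obtain l ys where l: "xs = l # ys"
    by (cases xs) (auto simp: P_def)
  have lV: "l \<in> verts T"
    using xs l by (simp add: P_def)
  have nb: "1 < length xs \<and> w = xs ! 1" if w: "{l, w} \<in> edges T" for w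
  proof -
    have wV: "w \<in> verts T" "w \<noteq> l"
      using simple_graph_edgeD[OF simple w] by auto
    have "w \<in> set xs"
    proof (rule ccontr)
      assume "w \<notin> set xs"
      then have "P (w # xs)"
        using xs wV w l by (auto simp: P_def nth_Cons insert_commute split: nat.splits)
      then show False
        using max by fastforce
    qed
    then obtain i where i: "i < length xs" "w = xs ! i"
      by (auto simp: in_set_conv_nth)
    have "i \<noteq> 0"
      using i l wV by (metis nth_Cons_0)
    moreover have "\<not> 2 \<le> i"
    proof
      assume "2 \<le> i"
      \<comment> \<open>The initial segment of the path up to \<open>w\<close> is closed by the edge
        from \<open>w\<close> back to \<open>l\<close>; \<open>2 \<le> i\<close> gives it at least
        three vertices.\<close>
      have "is_cycle T (take (Suc i) xs)"
        unfolding is_cycle_def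
      proof (intro conjI allI impI)
        show "3 \<le> length (take (Suc i) xs)"
          using i \<open>2 \<le> i\<close> by simp
        show "distinct (take (Suc i) xs)" "set (take (Suc i) xs) \<subseteq> verts T"
          using xs set_take_subset[of "Suc i" xs] by (auto simp: P_def)
        fix j assume "j < length (take (Suc i) xs)"
        then have j: "j \<le> i" by simp
        have len: "length (take (Suc i) xs) = Suc i"
          using i by simp
        show "{take (Suc i) xs ! j, take (Suc i) xs ! (Suc j mod length (take (Suc i) xs))} \<in> edges T"
        proof (cases "j = i")
          case True
          then show ?thesis
            using i w l by (simp add: len insert_commute del: take_Suc_Cons)
        next
          case False
          then have "Suc j < length xs" "Suc j mod Suc i = Suc j"
            using j i by auto
          then show ?thesis
            using xs j False unfolding len by (simp add: P_def)
        qed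
      qed
      then show False
        using T by (auto simp: is_tree_def)
    qed
    ultimately have "i = 1"
      by simp
    then show ?thesis
      using i by simp
  qed
  \<comment> \<open>That \<open>l\<close> has a neighbour at all comes from the first edge of a walk
    to a second vertex \<open>z\<close>.\<close>
  obtain z where z: "z \<in> verts T" "z \<noteq> l"
    using two[of l] lV by blast
  have "connected_on (edges T) (verts T)"
    using T connected_graph_iff_connected_on[OF simple] by (simp add: is_tree_def)
  from connected_onD[OF this lV z(1)] obtain y where "{l, y} \<in> edges T"
    using z(2) by (cases rule: converse_rtranclE) auto
  then show thesis
    using that[OF lV, of "xs ! 1"] nb simple_graph_edgeD[OF simple, of l y] by metis
qed

lemma is_tree_delete_leaf:
  assumes T: "is_tree T" and "p \<in> verts T" "p \<noteq> l" and leaf: "\<And>y. {l, y} \<in> edges T \<Longrightarrow> y = p"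
  shows "is_tree (del_vertex T l)"
  unfolding is_tree_def
proof (intro conjI)
  note simple = is_tree_simple[OF T]
  show "simple_graph (del_vertex T l)"
    unfolding simple_graph_def
  proof (intro conjI subsetI)
    fix e assume "e \<in> edges (del_vertex T l)"
    then have e: "e \<in> edges T" "e \<subseteq> verts T - {l}"
      by (auto simp: del_vertex_def induced_subgraph_def)
    then show "e \<in> [verts (del_vertex T l)]\<^bsup>2\<^esup>"
      using simple by (auto simp: del_vertex_def induced_subgraph_def simple_graph_def nsets_def)
  qed (use simple assms in \<open>auto simp: del_vertex_def induced_subgraph_def simple_graph_def\<close>)
  have "connected_on (edges T) (verts T)"
    using T connected_graph_iff_connected_on[OF simple] by (simp add: is_tree_def)
  then show "connected_graph (del_vertex T l)"
    unfolding del_vertex_def connected_graph_induced_subgraph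
    using assms by (intro connected_on_delete_leaf[where p = p])
  show "\<nexists>xs. is_cycle (del_vertex T l) xs"
    using T is_cycle_induced_subgraph[of T "verts T - {l}"] by (auto simp: is_tree_def del_vertex_def)
qed

text \<open>If the bag of a leaf is contained in the bag of its neighbour, the leaf can be deleted;
  otherwise some vertex occurs in no other bag, and all its neighbours are in the bag of the leaf.\<close>
lemma tree_decomposition_biclique:
  assumes "tree_decomposition G T \<beta>" "verts G = A \<union> B"
    and edges: "\<And>a b. a \<in> A \<Longrightarrow> b \<in> B \<Longrightarrow> {a, b} \<in> edges G"
  shows "\<exists>x\<in>verts T. A \<subseteq> \<beta> x \<or> B \<subseteq> \<beta> x"
  using assms(1)
proof (induction "card (verts T)" arbitrary: T rule: less_induct)
  case less
  then have T: "is_tree T" and bags: "\<And>v. v \<in> verts G \<Longrightarrow> \<exists>x\<in>verts T. v \<in> \<beta> x"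
    "\<And>e. e \<in> edges G \<Longrightarrow> \<exists>x\<in>verts T. e \<subseteq> \<beta> x" "\<And>x. x \<in> verts T \<Longrightarrow> \<beta> x \<subseteq> verts G"
    and conn: "\<And>v. v \<in> verts G \<Longrightarrow> connected_on (edges T) {x \<in> verts T. v \<in> \<beta> x}"
    by (simp_all add: tree_decomposition_def connected_graph_induced_subgraph)
  note simple = is_tree_simple[OF T]
  show ?case
  proof (cases "\<exists>r. verts T = {r}")
    case True
    then show ?thesis
      using bags(1) assms(2) by auto
  next
    case False
    then have nontriv: "verts T \<noteq> {r}" for r
      by blast
    obtain l p where l: "l \<in> verts T" "p \<in> verts T" "p \<noteq> l" "{l, p} \<in> edges T"
      and leaf': "\<forall>y. {l, y} \<in> edges T \<longrightarrow> y = p"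
      by (rule tree_leaf[OF T nontriv])
    note leaf = leaf'[rule_format]
    let ?T = "del_vertex T l"
    have vT: "verts ?T = verts T - {l}"
      by (simp add: del_vertex_def induced_subgraph_def)
    show ?thesis
    proof (cases "\<beta> l \<subseteq> \<beta> p")
      case True
      have "tree_decomposition G ?T \<beta>"
        unfolding tree_decomposition_def
      proof (intro conjI ballI)
        show "is_tree ?T"
          using T l(2,3) leaf by (rule is_tree_delete_leaf)
        show "\<beta> x \<subseteq> verts G" if "x \<in> verts ?T" for x
          using that bags(3) by (simp add: vT)
        show "\<exists>x\<in>verts ?T. v \<in> \<beta> x" if "v \<in> verts G" for v
          using bags(1)[OF that] True l unfolding vT by blast
        show "\<exists>x\<in>verts ?T. e \<subseteq> \<beta> x" if "e \<in> edges G" for e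
        proof -
          from bags(2)[OF that] obtain x where x: "x \<in> verts T" "e \<subseteq> \<beta> x" ..
          show ?thesis
            by (rule bexI[of _ "if x = l then p else x"]) (use x True l in \<open>auto simp: vT\<close>)
        qed
        fix v assume "v \<in> verts G"
        have "connected_on (edges T) ({x \<in> verts T. v \<in> \<beta> x} - {l})"
          by (rule connected_on_delete_leaf[OF conn[OF \<open>v \<in> verts G\<close>] leaf l(3)])
            (use l(2) True in auto)
        moreover have "{x \<in> verts T. v \<in> \<beta> x} - {l} = {x \<in> verts ?T. v \<in> \<beta> x}"
          by (auto simp: vT)
        ultimately have "connected_on (edges T) {x \<in> verts ?T. v \<in> \<beta> x}"
          by simp
        moreover have "{e \<in> {e \<in> edges T. e \<subseteq> verts T - {l}}. e \<subseteq> {x \<in> verts ?T. v \<in> \<beta> x}}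
            = {e \<in> edges T. e \<subseteq> {x \<in> verts ?T. v \<in> \<beta> x}}"
          by (auto simp: vT)
        ultimately show "connected_graph (induced_subgraph ?T {x \<in> verts ?T. v \<in> \<beta> x})"
          unfolding connected_graph_induced_subgraph[symmetric]
          by (simp add: induced_subgraph_def del_vertex_def)
      qed
      moreover have "card (verts ?T) < card (verts T)"
        unfolding vT using card_Diff1_less[OF simple_graph_finite[OF simple] l(1)] .
      ultimately obtain x where "x \<in> verts ?T" "A \<subseteq> \<beta> x \<or> B \<subseteq> \<beta> x"
        using less.hyps by blast
      then show ?thesis
        by (auto simp: vT)
    next
      case False
      then obtain v where v: "v \<in> \<beta> l" "v \<notin> \<beta> p"
        by auto
      then have vG: "v \<in> verts G"
        using bags(3)[OF l(1)] by auto
      \<comment> \<open>The nodes whose bags contain \<open>v\<close> are connected. A second such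
        node would put \<open>v\<close> into the bag of a neighbour of \<open>l\<close>, and the
        only neighbour is \<open>p\<close>.\<close>
      have only: "x = l" if x: "x \<in> verts T" "v \<in> \<beta> x" for x
      proof (rule ccontr)
        assume "x \<noteq> l"
        have "(l, x) \<in> {(x, y). {x, y} \<in> edges T \<and> {x, y} \<subseteq> {x \<in> verts T. v \<in> \<beta> x}}\<^sup>*"
          by (rule connected_onD[OF conn[OF vG]]) (use l v x in auto)
        then obtain y where "{l, y} \<in> edges T" "v \<in> \<beta> y"
          using \<open>x \<noteq> l\<close> by (cases rule: converse_rtranclE) auto
        then show False
          using leaf[of y] v(2) by simp
      qed
      have near: "u \<in> \<beta> l" if "{u, v} \<in> edges G" for u
        using bags(2)[OF that] only by auto
      \<comment> \<open>\<open>v\<close> is adjacent to the whole side opposite to its own, and all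
        its neighbours lie in \<open>\<beta> l\<close>.\<close>
      have "A \<subseteq> \<beta> l \<or> B \<subseteq> \<beta> l"
      proof (cases "v \<in> A")
        case True
        then have "B \<subseteq> \<beta> l"
          using edges near by (metis insert_commute subsetI)
        then show ?thesis ..
      next
        case False
        then have "v \<in> B"
          using vG assms(2) by auto
        then have "A \<subseteq> \<beta> l"
          using edges near by blast
        then show ?thesis ..
      qed
      then show ?thesis
        using l by auto
    qed
  qed
qed

section \<open>Attaching leaves and eliminating independent sets\<close>

text \<open>A cycle through the new node would give it two distinct neighbours, but \<open>x\<close>
  is its only one.\<close>

lemma is_tree_add_leaf:
  assumes T: "is_tree T" and x: "x \<in> verts T" and y: "y \<notin> verts T"
  shows "is_tree \<lparr>verts = insert y (verts T), edges = insert {x, y} (edges T)\<rparr>" (is "is_tree ?T")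
  unfolding is_tree_def
proof (intro conjI notI)
  note simple = is_tree_simple[OF T]
  have "[verts T]\<^bsup>2\<^esup> \<subseteq> [insert y (verts T)]\<^bsup>2\<^esup>"
    by (rule nsets_mono) auto
  moreover have "{x, y} \<in> [insert y (verts T)]\<^bsup>2\<^esup>"
    using x y by auto
  ultimately show simple': "simple_graph ?T"
    using simple x by (auto simp: simple_graph_def)
  have "connected_on (edges T) (verts T)"
    using T connected_graph_iff_connected_on[OF simple] by (simp add: is_tree_def)
  then have "connected_on (edges ?T) (verts T)"
    by (rule connected_on_mono_edges) auto
  then have "connected_on (edges ?T) (insert y (verts T))"
    using x by (rule connected_on_insert) simp
  then show "connected_graph ?T"
    using connected_graph_iff_connected_on[OF simple'] by simp
  assume "\<exists>xs. is_cycle ?T xs"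
  then obtain xs where len: "3 \<le> length xs" and dist: "distinct xs"
    and sub: "set xs \<subseteq> insert y (verts T)"
    and cyc: "\<And>i. i < length xs \<Longrightarrow> {xs ! i, xs ! (Suc i mod length xs)} \<in> insert {x, y} (edges T)"
    by (auto simp: is_cycle_def)
  have yT: "{u, y} \<notin> edges T" "{y, u} \<notin> edges T" for u
    using simple_graph_edgeD[OF simple] y by blast+
  show False
  proof (cases "y \<in> set xs")
    case False
    have "is_cycle T xs"
      unfolding is_cycle_def
    proof (intro conjI allI impI)
      fix i assume i: "i < length xs"
      then have "Suc i mod length xs < length xs"
        using len by (intro mod_less_divisor) auto
      then have "y \<notin> {xs ! i, xs ! (Suc i mod length xs)}"
        using False i by (metis insertE nth_mem singletonD)
      then show "{xs ! i, xs ! (Suc i mod length xs)} \<in> edges T"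
        using cyc[OF i] by auto
    qed (use False len dist sub in auto)
    then show False
      using T by (auto simp: is_tree_def)
  next
    case True
    then obtain i where i: "i < length xs" "xs ! i = y"
      by (auto simp: in_set_conv_nth)
    let ?n = "length xs"
    \<comment> \<open>Cyclic predecessor and successor of position \<open>i\<close>, distinct
      because the cycle has length at least 3.\<close>
    define j where "j = (if i = 0 then ?n - 1 else i - 1)"
    define k where "k = (if Suc i = ?n then 0 else Suc i)"
    have jk: "j < ?n" "k < ?n" "j \<noteq> k" "Suc j mod ?n = i" "Suc i mod ?n = k"
      using i len by (auto simp: j_def k_def)
    have "{xs ! j, y} = {x, y}" "{y, xs ! k} = {x, y}"
      using cyc[OF jk(1)] cyc[OF i(1)] i(2) jk yT by auto
    then have "xs ! j = xs ! k"
      using x y by (auto simp: doubleton_eq_iff)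
    then show False
      using jk dist by (simp add: nth_eq_iff_index_eq)
  qed
qed

definition neighbours :: "'a ugraph \<Rightarrow> 'a \<Rightarrow> 'a set" where
  "neighbours G v = {u. {v, u} \<in> edges G}"

text \<open>The leaf \<open>y\<close> covers \<open>v\<close> and all its edges. Only neighbours of
  \<open>v\<close> newly occur at \<open>y\<close>, and they already occur at \<open>x\<close>, so
  their node sets stay connected.\<close>

lemma tree_decomposition_add_vertex:
  assumes simple: "simple_graph G" and dec: "tree_decomposition (induced_subgraph G W) T \<beta>"
    and v: "v \<notin> W" and x: "x \<in> verts T" "neighbours G v \<subseteq> \<beta> x" and y: "y \<notin> verts T"
  shows "tree_decomposition (induced_subgraph G (insert v W))
    \<lparr>verts = insert y (verts T), edges = insert {x, y} (edges T)\<rparr>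
    (\<beta>(y := insert v (neighbours G v)))" (is "tree_decomposition ?G ?T ?\<beta>")
  unfolding tree_decomposition_def
proof (intro conjI ballI)
  have T: "is_tree T" and bags: "\<And>v. v \<in> W \<Longrightarrow> \<exists>x\<in>verts T. v \<in> \<beta> x"
    "\<And>e. e \<in> edges G \<Longrightarrow> e \<subseteq> W \<Longrightarrow> \<exists>x\<in>verts T. e \<subseteq> \<beta> x" "\<And>x. x \<in> verts T \<Longrightarrow> \<beta> x \<subseteq> W"
    and conn: "\<And>v. v \<in> W \<Longrightarrow> connected_on (edges T) {x \<in> verts T. v \<in> \<beta> x}"
    using dec by (simp_all add: tree_decomposition_def connected_graph_induced_subgraph)
      (simp_all add: induced_subgraph_def)
  have same: "?\<beta> z = \<beta> z" if "z \<in> verts T" for z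
    using that y by auto
  show "is_tree ?T"
    using T x(1) y by (rule is_tree_add_leaf)
  show "?\<beta> z \<subseteq> verts ?G" if "z \<in> verts ?T" for z
    using that bags(3) bags(3)[OF x(1)] x(2) by (auto simp: induced_subgraph_def)
  show "\<exists>z\<in>verts ?T. u \<in> ?\<beta> z" if "u \<in> verts ?G" for u
    using that bags(1)[of u] same by (auto simp: induced_subgraph_def)
  show "\<exists>z\<in>verts ?T. e \<subseteq> ?\<beta> z" if "e \<in> edges ?G" for e
  proof (cases "v \<in> e")
    case False
    then have "e \<in> edges G" "e \<subseteq> W"
      using that by (auto simp: induced_subgraph_def)
    from bags(2)[OF this] show ?thesis
      using same by auto
  next
    case True
    have "e \<in> edges G"
      using that by (simp add: induced_subgraph_def)
    then obtain a b where "e = {a, b}"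
      by (rule simple_graph_edgeE[OF simple])
    then have "e \<subseteq> insert v (neighbours G v)"
      using True \<open>e \<in> edges G\<close> by (auto simp: neighbours_def insert_commute)
    then show ?thesis
      by auto
  qed
  show "connected_graph (induced_subgraph ?T {z \<in> verts ?T. u \<in> ?\<beta> z})" if u: "u \<in> verts ?G" for u
    unfolding connected_graph_induced_subgraph
  proof (cases "u = v")
    case True
    then have "{z \<in> verts ?T. u \<in> ?\<beta> z} = {y}"
      using bags(3) v y by auto
    then show "connected_on (edges ?T) {z \<in> verts ?T. u \<in> ?\<beta> z}"
      by (simp only: connected_on_singleton)
  next
    case False
    then have "u \<in> W"
      using u by (simp add: induced_subgraph_def)
    from conn[OF this] have *: "connected_on (edges ?T) {z \<in> verts T. u \<in> \<beta> z}"
      by (rule connected_on_mono_edges) auto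
    show "connected_on (edges ?T) {z \<in> verts ?T. u \<in> ?\<beta> z}"
    proof (cases "u \<in> neighbours G v")
      case True
      then have "{z \<in> verts ?T. u \<in> ?\<beta> z} = insert y {z \<in> verts T. u \<in> \<beta> z}"
        using y by auto
      moreover have "connected_on (edges ?T) (insert y {z \<in> verts T. u \<in> \<beta> z})"
        using * by (rule connected_on_insert[where x = x]) (use x True in auto)
      ultimately show ?thesis
        by simp
    next
      case uv: False
      then have "{z \<in> verts ?T. u \<in> ?\<beta> z} = {z \<in> verts T. u \<in> \<beta> z}"
        using y False by auto
      then show ?thesis
        using * by simp
    qed
  qed
qed

text \<open>A remaining vertex \<open>u\<close> now occurs where it did before or where a neighbour
  in \<open>I\<close> did. Each such neighbour shares a bag with \<open>u\<close>, so this union is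
  connected. Independence of \<open>I\<close> keeps the added neighbourhoods disjoint from
  \<open>I\<close>.\<close>

lemma tree_decomposition_eliminate:
  assumes simple: "simple_graph G" and dec: "tree_decomposition G T \<beta>"
    and I: "I \<subseteq> verts G" "indep I (edges G)"
  shows "tree_decomposition (induced_subgraph G (verts G - I)) T
    (\<lambda>x. \<beta> x - I \<union> (\<Union>v\<in>\<beta> x \<inter> I. neighbours G v))" (is "tree_decomposition ?G T ?\<beta>")
  unfolding tree_decomposition_def
proof (intro conjI ballI)
  have T: "is_tree T" and bags: "\<And>v. v \<in> verts G \<Longrightarrow> \<exists>x\<in>verts T. v \<in> \<beta> x"
    "\<And>e. e \<in> edges G \<Longrightarrow> \<exists>x\<in>verts T. e \<subseteq> \<beta> x" "\<And>x. x \<in> verts T \<Longrightarrow> \<beta> x \<subseteq> verts G"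
    and conn: "\<And>v. v \<in> verts G \<Longrightarrow> connected_on (edges T) {x \<in> verts T. v \<in> \<beta> x}"
    using dec by (simp_all add: tree_decomposition_def connected_graph_induced_subgraph)
  have nb: "u \<in> verts G - I" if "v \<in> I" "u \<in> neighbours G v" for u v
    using that I simple_graph_edgeD[OF simple, of v u] by (auto simp: neighbours_def indep_def)
  show "is_tree T"
    by (rule T)
  show "?\<beta> x \<subseteq> verts ?G" if "x \<in> verts T" for x
    using bags(3)[OF that] nb by (auto simp: induced_subgraph_def)
  show "\<exists>x\<in>verts T. u \<in> ?\<beta> x" if "u \<in> verts ?G" for u
    using bags(1)[of u] that by (auto simp: induced_subgraph_def)
  show "\<exists>x\<in>verts T. e \<subseteq> ?\<beta> x" if "e \<in> edges ?G" for e
  proof -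
    have "e \<in> edges G" "e \<inter> I = {}"
      using that by (auto simp: induced_subgraph_def)
    from bags(2)[OF this(1)] obtain x where "x \<in> verts T" "e \<subseteq> \<beta> x" ..
    then have "e \<subseteq> ?\<beta> x"
      using \<open>e \<inter> I = {}\<close> by blast
    with \<open>x \<in> verts T\<close> show ?thesis ..
  qed
  fix u assume "u \<in> verts ?G"
  then have u: "u \<in> verts G" "u \<notin> I"
    by (auto simp: induced_subgraph_def)
  have "connected_on (edges T) ({x \<in> verts T. u \<in> \<beta> x} \<union>
      (\<Union>v\<in>I \<inter> neighbours G u. {x \<in> verts T. v \<in> \<beta> x}))"
  proof (rule connected_on_UN)
    fix v assume v: "v \<in> I \<inter> neighbours G u"
    then show "connected_on (edges T) {x \<in> verts T. v \<in> \<beta> x}"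
      using I conn by auto
    obtain x where "x \<in> verts T" "{u, v} \<subseteq> \<beta> x"
      using bags(2)[of "{u, v}"] v by (auto simp: neighbours_def)
    then show "{x \<in> verts T. u \<in> \<beta> x} \<inter> {x \<in> verts T. v \<in> \<beta> x} \<noteq> {}"
      by auto
  qed (rule conn[OF u(1)])
  moreover have "{x \<in> verts T. u \<in> \<beta> x} \<union> (\<Union>v\<in>I \<inter> neighbours G u. {x \<in> verts T. v \<in> \<beta> x}) =
      {x \<in> verts T. u \<in> ?\<beta> x}"
    using u by (auto simp: neighbours_def insert_commute)
  ultimately show "connected_graph (induced_subgraph T {x \<in> verts T. u \<in> ?\<beta> x})"
    by (simp add: connected_graph_induced_subgraph)
qed

text \<open>First all of \<open>I\<close> is eliminated, then its vertices return one at a time,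
  each in the bag of a new leaf.\<close>

lemma tree_decomposition_neighbourhood_swap:
  assumes simple: "simple_graph G" and dec: "tree_decomposition G T \<beta>"
    and I: "I \<subseteq> verts G" "indep I (edges G)"
  obtains T' \<beta>' where "tree_decomposition G T' \<beta>'"
    "\<And>x. x \<in> verts T' \<Longrightarrow>
      (\<exists>z\<in>verts T. \<beta>' x = \<beta> z - I \<union> (\<Union>v\<in>\<beta> z \<inter> I. neighbours G v)) \<or>
      (\<exists>v\<in>I. \<beta>' x = insert v (neighbours G v))"
proof -
  define good where "good X \<longleftrightarrow> (\<exists>z\<in>verts T. X = \<beta> z - I \<union> (\<Union>v\<in>\<beta> z \<inter> I. neighbours G v)) \<or>
      (\<exists>v\<in>I. X = insert v (neighbours G v))" for X
  have fin: "finite I"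
    using I(1) simple_graph_finite[OF simple] by (rule finite_subset)
  \<comment> \<open>\<open>J\<close> is the part of \<open>I\<close> already restored. The invariant
    that every neighbourhood of a vertex of \<open>I\<close> fits into a bag provides the node to
    which the next leaf is attached; initially any node whose bag in \<open>\<beta>\<close>
    contained \<open>v\<close> will do.\<close>
  have "\<exists>T' \<beta>'. tree_decomposition (induced_subgraph G (verts G - I \<union> J)) T' \<beta>' \<and>
      (\<forall>v\<in>I. \<exists>x\<in>verts T'. neighbours G v \<subseteq> \<beta>' x) \<and> (\<forall>x\<in>verts T'. good (\<beta>' x))"
    if "J \<subseteq> I" for J
    using finite_subset[OF that fin] that
  proof (induction J)
    case empty
    let ?\<beta> = "\<lambda>x. \<beta> x - I \<union> (\<Union>v\<in>\<beta> x \<inter> I. neighbours G v)"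
    have "\<exists>x\<in>verts T. neighbours G v \<subseteq> ?\<beta> x" if v: "v \<in> I" for v
    proof -
      have "\<forall>v\<in>verts G. \<exists>x\<in>verts T. v \<in> \<beta> x"
        using dec by (simp add: tree_decomposition_def)
      then obtain x where "x \<in> verts T" "v \<in> \<beta> x"
        using v I(1) by blast
      then show ?thesis
        using v by auto
    qed
    moreover have "\<forall>x\<in>verts T. good (?\<beta> x)"
      by (auto simp: good_def)
    ultimately show ?case
      using tree_decomposition_eliminate[OF assms] by (intro exI[of _ T] exI[of _ ?\<beta>]) simp
  next
    case (insert v J)
    then obtain T' \<beta>' where dec': "tree_decomposition (induced_subgraph G (verts G - I \<union> J)) T' \<beta>'"
      and nbs: "\<And>w. w \<in> I \<Longrightarrow> \<exists>x\<in>verts T'. neighbours G w \<subseteq> \<beta>' x"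
      and bags: "\<And>x. x \<in> verts T' \<Longrightarrow> good (\<beta>' x)"
      by auto
    have "finite (verts T')"
      using dec' by (simp add: tree_decomposition_def is_tree_def simple_graph_def)
    then obtain y where y: "y \<notin> verts T'"
      using ex_new_if_finite infinite_UNIV_nat by blast
    obtain x where x: "x \<in> verts T'" "neighbours G v \<subseteq> \<beta>' x"
      using nbs[of v] insert.prems by auto
    have "v \<notin> verts G - I \<union> J"
      using insert by auto
    note new = tree_decomposition_add_vertex[OF simple dec' this x y]
    have eq: "insert v (verts G - I \<union> J) = verts G - I \<union> insert v J"
      by auto
    let ?\<beta> = "\<beta>'(y := insert v (neighbours G v))"
    have "\<exists>x\<in>insert y (verts T'). neighbours G w \<subseteq> ?\<beta> x" if w: "w \<in> I" for w
    proof -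
      from nbs[OF w] obtain z where z: "z \<in> verts T'" "neighbours G w \<subseteq> \<beta>' z" ..
      then have "neighbours G w \<subseteq> ?\<beta> z"
        using y by auto
      then show ?thesis
        using z(1) by blast
    qed
    moreover have "good (?\<beta> z)" if "z \<in> insert y (verts T')" for z
      using that bags y insert.prems by (auto simp: good_def)
    ultimately show ?case
      using new unfolding eq
      by (intro exI[of _ "\<lparr>verts = insert y (verts T'), edges = insert {x, y} (edges T')\<rparr>"] exI[of _ ?\<beta>])
        (simp del: fun_upd_apply)
  qed
  from this[OF subset_refl] obtain T' \<beta>' where
    "tree_decomposition (induced_subgraph G (verts G - I \<union> I)) T' \<beta>'"
    and bags: "\<And>x. x \<in> verts T' \<Longrightarrow> good (\<beta>' x)"
    by auto
  moreover have "verts G - I \<union> I = verts G"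
    using I(1) by auto
  moreover have "{e \<in> edges G. e \<subseteq> verts G} = edges G"
    by (auto elim: simple_graph_edgeE[OF simple])
  then have "tree_decomposition (induced_subgraph G (verts G)) T' \<beta>' = tree_decomposition G T' \<beta>'"
    by (simp add: tree_decomposition_def induced_subgraph_def)
  ultimately have "tree_decomposition G T' \<beta>'"
    by simp
  then show thesis
    using bags unfolding good_def by (rule that)
qed

section \<open>Comparison of the two parameters\<close>

lemma alpha_leI:
  assumes "finite X" "\<And>S. S \<subseteq> X \<Longrightarrow> indep S (edges G) \<Longrightarrow> card S \<le> m"
  shows "alpha G X \<le> m"
  unfolding alpha_def
proof (rule Max.boundedI)
  show "finite {card S |S. S \<subseteq> X \<and> indep S (edges G)}"
    using assms(1) by simp
  show "{card S |S. S \<subseteq> X \<and> indep S (edges G)} \<noteq> {}"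
    using null_indep by blast
qed (use assms(2) in auto)

lemma alpha_attained:
  assumes "finite X"
  obtains S where "S \<subseteq> X" "indep S (edges G)" "card S = alpha G X"
proof -
  have "alpha G X \<in> {card S |S. S \<subseteq> X \<and> indep S (edges G)}"
    unfolding alpha_def
  proof (rule Max_in)
    show "finite {card S |S. S \<subseteq> X \<and> indep S (edges G)}"
      using assms by simp
    show "{card S |S. S \<subseteq> X \<and> indep S (edges G)} \<noteq> {}"
      using null_indep by blast
  qed
  then show thesis
    using that by auto
qed

lemma card_le_alpha:
  "finite X \<Longrightarrow> S \<subseteq> X \<Longrightarrow> indep S (edges G) \<Longrightarrow> card S \<le> alpha G X"
  unfolding alpha_def by (rule Max_ge) auto

lemma simple_graph_finite_edges:
  assumes "simple_graph G"
  shows "finite (edges G)"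
proof -
  have "edges G \<subseteq> Pow (verts G)"
    using assms by (auto simp: simple_graph_def nsets_def)
  then show ?thesis
    using simple_graph_finite[OF assms] by (meson finite_Pow_iff finite_subset)
qed

lemma finite_induced_matchings:
  assumes "simple_graph G"
  shows "finite {card M |M. induced_matching G M \<and> touches M X}"
proof -
  have "{M. induced_matching G M \<and> touches M X} \<subseteq> Pow (edges G)"
    by (auto simp: induced_matching_def)
  then have "finite {M. induced_matching G M \<and> touches M X}"
    using simple_graph_finite_edges[OF assms] by (meson finite_Pow_iff finite_subset)
  then show ?thesis
    by simp
qed

lemma mu_leI:
  assumes "simple_graph G" "\<And>M. induced_matching G M \<Longrightarrow> touches M X \<Longrightarrow> card M \<le> m"
  shows "mu G X \<le> m"
  unfolding mu_def
proof (rule Max.boundedI)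
  have "induced_matching G {} \<and> touches {} X"
    by (simp add: induced_matching_def touches_def)
  then show "{card M |M. induced_matching G M \<and> touches M X} \<noteq> {}"
    by blast
qed (use assms finite_induced_matchings in auto)

lemma card_le_mu:
  assumes "simple_graph G" "induced_matching G M" "touches M X"
  shows "card M \<le> mu G X"
  unfolding mu_def using assms by (intro Max_ge finite_induced_matchings) auto

text \<open>Choosing from each matching edge an endpoint in \<open>X\<close> gives distinct,
  pairwise nonadjacent vertices, as the matching is induced.\<close>

lemma mu_le_alpha:
  assumes simple: "simple_graph G" and X: "X \<subseteq> verts G"
  shows "mu G X \<le> alpha G X"
  using simple
proof (rule mu_leI)
  fix M assume M: "induced_matching G M" "touches M X"
  then have "\<forall>e\<in>M. \<exists>v. v \<in> e \<inter> X"
    by (auto simp: touches_def)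
  then obtain f where f: "\<And>e. e \<in> M \<Longrightarrow> f e \<in> e \<inter> X"
    by metis
  have disj: "e \<inter> e' = {}" "{u, v} \<notin> edges G"
    if "e \<in> M" "e' \<in> M" "e \<noteq> e'" "u \<in> e" "v \<in> e'" for e e' u v
    using M that unfolding induced_matching_def by blast+
  have "inj_on f M"
  proof (rule inj_onI, rule ccontr)
    fix e e' assume "e \<in> M" "e' \<in> M" "f e = f e'" "e \<noteq> e'"
    then show False
      using f[of e] f[of e'] disj(1)[of e e' "f e" "f e'"] by auto
  qed
  then have "card M = card (f ` M)"
    by (simp add: card_image)
  also have "\<dots> \<le> alpha G X"
  proof (rule card_le_alpha)
    show "finite X"
      using X simple_graph_finite[OF simple] by (rule finite_subset)
    show "f ` M \<subseteq> X"
      using f by auto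
    show "indep (f ` M) (edges G)"
      unfolding indep_def
    proof (intro ballI impI)
      fix u v assume "u \<in> f ` M" "v \<in> f ` M" "u \<noteq> v"
      then obtain e e' where e: "e \<in> M" "e' \<in> M" "u = f e" "v = f e'" "e \<noteq> e'"
        by auto
      then show "{u, v} \<notin> edges G"
        using f[of e] f[of e'] by (intro disj(2)[of e e']) auto
    qed
  qed
  finally show "card M \<le> alpha G X" .
qed

text \<open>Turns the pairs \<open>v\<close>, \<open>f v\<close> found by the combinatorial lemmas
  into an induced matching. The pairs are disjoint: \<open>f v = f w\<close> would make
  \<open>{v, f w}\<close> an edge, and \<open>v = f w\<close> would make \<open>{w, v}\<close> an
  edge inside \<open>M\<close>.\<close>

lemma card_le_mu_pairing:
  assumes simple: "simple_graph G" and M: "indep M (edges G)"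
    and f: "\<And>v. v \<in> M \<Longrightarrow> {v, f v} \<in> edges G"
    and ind: "\<And>v w. v \<in> M \<Longrightarrow> w \<in> M \<Longrightarrow> v \<noteq> w \<Longrightarrow> {v, f w} \<notin> edges G \<and> {f v, f w} \<notin> edges G"
    and touch: "M \<subseteq> X \<or> f ` M \<subseteq> X"
  shows "card M \<le> mu G X"
proof -
  let ?M = "(\<lambda>v. {v, f v}) ` M"
  \<comment> \<open>For \<open>v = w\<close> this is the absence of loops.\<close>
  have M': "{v, w} \<notin> edges G" if "v \<in> M" "w \<in> M" for v w
    using that M simple_graph_edgeD(3)[OF simple, of v w] by (auto simp: indep_def)
  have "inj_on (\<lambda>v. {v, f v}) M"
  proof (rule inj_onI, rule ccontr)
    fix v w assume vw: "v \<in> M" "w \<in> M" "{v, f v} = {w, f w}" "v \<noteq> w"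
    then have "{v, f v} = {v, w}"
      by (auto simp: doubleton_eq_iff)
    then show False
      using f[OF vw(1)] M'[OF vw(1,2)] by simp
  qed
  then have "card M = card ?M"
    by (simp add: card_image)
  also have "\<dots> \<le> mu G X"
    using simple
  proof (rule card_le_mu)
    have *: "{u, u'} \<notin> edges G" if "v \<in> M" "w \<in> M" "v \<noteq> w" "u \<in> {v, f v}" "u' \<in> {w, f w}" for v w u u'
      using that ind[of v w] ind[of w v] M'[of v w] by (auto simp: insert_commute)
    have disj: "{v, f v} \<inter> {w, f w} = {}" if vw: "v \<in> M" "w \<in> M" "v \<noteq> w" for v w
    proof -
      have "v \<noteq> f w" "f v \<noteq> w" "f v \<noteq> f w"
        using M'[OF vw(1,2)] f[OF vw(1)] f[OF vw(2)] ind[OF vw] by (auto simp: insert_commute)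
      then show ?thesis
        using vw(3) by auto
    qed
    show "induced_matching G ?M"
      unfolding induced_matching_def
    proof (intro conjI ballI impI)
      show "?M \<subseteq> edges G"
        using f by auto
      fix e e' assume "e \<in> ?M" "e' \<in> ?M" "e \<noteq> e'"
      then obtain v w where vw: "v \<in> M" "w \<in> M" "v \<noteq> w" and e: "e = {v, f v}" "e' = {w, f w}"
        by auto
      show "e \<inter> e' = {}"
        unfolding e using vw by (rule disj)
      fix u u' assume "u \<in> e" "u' \<in> e'"
      then show "{u, u'} \<notin> edges G"
        unfolding e by (rule *[OF vw])
    qed
    show "touches ?M X"
      using touch by (auto simp: touches_def)
  qed
  finally show ?thesis .
qed

section \<open>Optimal tree decompositions\<close>

text \<open>Makes the sets under both infima nonempty, and serves as the witness that
  \<open>tree_mu\<close> is at most 1 for bicliques.\<close>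

lemma single_bag_tree_decomposition:
  assumes simple: "simple_graph G"
  shows "tree_decomposition G \<lparr>verts = {0}, edges = {}\<rparr> (\<lambda>_. verts G)"
proof -
  have "\<not> is_cycle \<lparr>verts = {0 :: nat}, edges = {}\<rparr> xs" for xs
    by (auto simp: is_cycle_def intro!: exI[of _ 0])
  then have "is_tree \<lparr>verts = {0 :: nat}, edges = {}\<rparr>"
    by (simp add: is_tree_def simple_graph_def connected_graph_def)
  moreover have "e \<subseteq> verts G" if "e \<in> edges G" for e
    using simple that by (auto simp: simple_graph_def nsets_def)
  ultimately show ?thesis
    by (auto simp: tree_decomposition_def connected_graph_def induced_subgraph_def)
qed

lemma tree_decomposition_nodes:
  "tree_decomposition G T \<beta> \<Longrightarrow> finite (verts T) \<and> verts T \<noteq> {}"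
  by (simp add: tree_decomposition_def is_tree_def simple_graph_def)

lemma tree_decomposition_bag_subset:
  "tree_decomposition G T \<beta> \<Longrightarrow> x \<in> verts T \<Longrightarrow> \<beta> x \<subseteq> verts G"
  by (simp add: tree_decomposition_def)

lemma tree_alpha_leI:
  assumes "tree_decomposition G T \<beta>" "\<And>x. x \<in> verts T \<Longrightarrow> alpha G (\<beta> x) \<le> m"
  shows "tree_alpha G \<le> m"
proof -
  have "tree_alpha G \<le> decomp_alpha G T \<beta>"
    unfolding tree_alpha_def using assms(1) by (intro cInf_lower) auto
  also have "\<dots> \<le> m"
    unfolding decomp_alpha_def using tree_decomposition_nodes[OF assms(1)] assms(2) by simp
  finally show ?thesis .
qed

lemma tree_mu_leI:
  assumes "tree_decomposition G T \<beta>" "\<And>x. x \<in> verts T \<Longrightarrow> mu G (\<beta> x) \<le> m"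
  shows "tree_mu G \<le> m"
proof -
  have "tree_mu G \<le> decomp_mu G T \<beta>"
    unfolding tree_mu_def using assms(1) by (intro cInf_lower) auto
  also have "\<dots> \<le> m"
    unfolding decomp_mu_def using tree_decomposition_nodes[OF assms(1)] assms(2) by simp
  finally show ?thesis .
qed

lemma tree_alpha_attained:
  assumes "simple_graph G"
  obtains T \<beta> where "tree_decomposition G T \<beta>" "\<forall>x\<in>verts T. alpha G (\<beta> x) \<le> tree_alpha G"
proof -
  have "tree_alpha G \<in> {decomp_alpha G T \<beta> |T \<beta>. tree_decomposition G T \<beta>}"
    unfolding tree_alpha_def using single_bag_tree_decomposition[OF assms] by (intro Inf_nat_def1) blast
  then obtain T \<beta> where "tree_decomposition G T \<beta>" "tree_alpha G = decomp_alpha G T \<beta>"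
    by blast
  then show thesis
    using that tree_decomposition_nodes unfolding decomp_alpha_def by fastforce
qed

lemma tree_mu_attained:
  assumes "simple_graph G"
  obtains T \<beta> where "tree_decomposition G T \<beta>" "\<forall>x\<in>verts T. mu G (\<beta> x) \<le> tree_mu G"
proof -
  have "tree_mu G \<in> {decomp_mu G T \<beta> |T \<beta>. tree_decomposition G T \<beta>}"
    unfolding tree_mu_def using single_bag_tree_decomposition[OF assms] by (intro Inf_nat_def1) blast
  then obtain T \<beta> where "tree_decomposition G T \<beta>" "tree_mu G = decomp_mu G T \<beta>"
    by blast
  then show thesis
    using that tree_decomposition_nodes unfolding decomp_mu_def by fastforce
qed

text \<open>A decomposition that is optimal for \<open>alpha\<close> is compared bag by bag. This
  direction holds in every graph.\<close>

lemma tree_mu_le_tree_alpha: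
  assumes "simple_graph G"
  shows "tree_mu G \<le> tree_alpha G"
proof -
  obtain T \<beta> where T: "tree_decomposition G T \<beta>" "\<forall>x\<in>verts T. alpha G (\<beta> x) \<le> tree_alpha G"
    using assms by (rule tree_alpha_attained)
  show ?thesis
    using T(1)
  proof (rule tree_mu_leI)
    fix x assume x: "x \<in> verts T"
    have "mu G (\<beta> x) \<le> alpha G (\<beta> x)"
      by (rule mu_le_alpha[OF assms tree_decomposition_bag_subset[OF T(1) x]])
    then show "mu G (\<beta> x) \<le> tree_alpha G"
      using T(2) x by force
  qed
qed

section \<open>Bounding \<open>tree_alpha\<close> by \<open>tree_mu\<close> in the absence of large
  bicliques\<close>

lemma tree_alpha_bounded_by_tree_mu:
  assumes "0 < n"
  shows "\<exists>C. \<forall>G :: 'a ugraph. simple_graph G \<longrightarrow> biclique_free n (edges G) \<longrightarrow> tree_mu G \<le> k \<longrightarrow> tree_alpha G \<le> C"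
proof -
  \<comment> \<open>The matching size \<open>Suc k\<close> is one more than a bag of an optimal
    decomposition can allow.\<close>
  obtain N c where Nc: "\<forall>(E :: 'a set set) V A. biclique_free n E \<longrightarrow> finite V \<longrightarrow> indep V E \<longrightarrow> N \<le> card V \<longrightarrow>
     (\<forall>v\<in>V. finite (A v) \<and> indep (A v) E \<and> c \<le> card (A v) \<and> (\<forall>a\<in>A v. {v, a} \<in> E)) \<longrightarrow>
     (\<exists>M f. M \<subseteq> V \<and> card M = Suc k \<and>
        (\<forall>v\<in>M. f v \<in> A v \<and> (\<forall>w\<in>M. v \<noteq> w \<longrightarrow> {v, f w} \<notin> E \<and> {f v, f w} \<notin> E)))"
    using induced_matching_of_large_neighbourhoods[OF assms, of "Suc k"] by (elim exE)
  \<comment> \<open>\<open>N\<close> accounts for high vertices, one \<open>c * k\<close> for low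
    vertices outside \<open>I\<close>, the other for neighbours of \<open>I\<close>, and the last
    \<open>c\<close> for the bags of the new leaves.\<close>
  have bound: "tree_alpha G \<le> N + c * k + c * k + c"
    if simple: "simple_graph G" and free: "biclique_free n (edges G)" and k: "tree_mu G \<le> k"
    for G :: "'a ugraph"
  proof -
    let ?E = "edges G"
    let ?N = "neighbours G"
    note fin = simple_graph_finite[OF simple]
    obtain T \<beta> where dec: "tree_decomposition G T \<beta>" and mu: "\<forall>x\<in>verts T. mu G (\<beta> x) \<le> tree_mu G"
      using simple by (rule tree_mu_attained)
    have nbV: "?N v \<subseteq> verts G" for v
      using simple_graph_edgeD[OF simple] by (auto simp: neighbours_def)
    then have nbfin: "finite (?N v)" for v
      using fin by (rule finite_subset)
    define L where "L = {v \<in> verts G. alpha G (?N v) < c}"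
    have low: "card S < c" if "v \<in> L" "S \<subseteq> ?N v" "indep S ?E" for v S
      using card_le_alpha[OF nbfin that(2,3)] that(1) by (simp add: L_def)
    define P where "P I \<longleftrightarrow> I \<subseteq> L \<and> indep I ?E" for I
    have finL: "finite L"
      using fin by (simp add: L_def)
    have "P {}"
      by (simp add: P_def)
    moreover have "card I < Suc (card L)" if "P I" for I
      using that card_mono[OF finL, of I] by (simp add: P_def)
    \<comment> \<open>Maximum cardinality is used, and it implies that every low vertex outside
      \<open>I\<close> has a neighbour in \<open>I\<close>.\<close>
    ultimately obtain I where "P I" and max: "\<And>I'. P I' \<Longrightarrow> card I' \<le> card I"
      using ex_has_greatest_nat[of P "{}" card "Suc (card L)"] by (auto simp: less_imp_le)
    then have I: "I \<subseteq> L" "indep I ?E"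
      by (simp_all add: P_def)
    have finI: "finite I"
      using I(1) finL by (rule finite_subset)
    have IV: "I \<subseteq> verts G"
      using I(1) by (auto simp: L_def)
    have dom: "\<exists>d\<in>I. {d, v} \<in> ?E" if v: "v \<in> L" "v \<notin> I" for v
    proof (rule ccontr)
      assume "\<not> ?thesis"
      then have "P (insert v I)"
        using I v by (auto simp: P_def indep_def insert_commute)
      from max[OF this] show False
        using v finI by simp
    qed
    obtain T' \<beta>' where dec': "tree_decomposition G T' \<beta>'"
      and bags: "\<And>x. x \<in> verts T' \<Longrightarrow>
        (\<exists>z\<in>verts T. \<beta>' x = \<beta> z - I \<union> (\<Union>v\<in>\<beta> z \<inter> I. ?N v)) \<or> (\<exists>v\<in>I. \<beta>' x = insert v (?N v))"
      using tree_decomposition_neighbourhood_swap[OF simple dec IV I(2)] by metis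
    have swapped: "card S \<le> N + c * k + c * k"
      if z: "z \<in> verts T" and S: "S \<subseteq> \<beta> z - I \<union> (\<Union>v\<in>\<beta> z \<inter> I. ?N v)" "indep S ?E" for S z
    proof -
      have muz: "mu G (\<beta> z) \<le> k"
        using mu z k by force
      have bz: "\<beta> z \<subseteq> verts G"
        using dec z by (rule tree_decomposition_bag_subset)
      \<comment> \<open>High vertices of the old bag, its low vertices outside \<open>I\<close>, and
        vertices brought in by neighbourhoods. The last part may overlap the others; only a cover of
        \<open>S\<close> is needed.\<close>
      define S1 where "S1 = S \<inter> \<beta> z - L"
      define S2 where "S2 = S \<inter> \<beta> z \<inter> L - I"
      define S3 where "S3 = S \<inter> (\<Union>v\<in>\<beta> z \<inter> I. ?N v)"
      have ind: "indep S1 ?E" "indep S2 ?E" "indep S3 ?E"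
        by (rule smaller_indep[OF S(2)], auto simp: S1_def S2_def S3_def)+
      have "S1 \<subseteq> verts G" "S2 \<subseteq> verts G" "S3 \<subseteq> verts G"
        using bz nbV by (auto simp: S1_def S2_def S3_def)
      then have finS: "finite S1" "finite S2" "finite S3"
        using fin by (auto intro: finite_subset)
      have "card S1 \<le> N"
      proof (rule ccontr)
        assume "\<not> ?thesis"
        then have large: "N \<le> card S1"
          by simp
        have "\<exists>A. A \<subseteq> ?N v \<and> indep A ?E \<and> c \<le> card A" if v: "v \<in> S1" for v
        proof -
          obtain A where "A \<subseteq> ?N v" "indep A ?E" "card A = alpha G (?N v)"
            using nbfin by (rule alpha_attained)
          moreover have "c \<le> alpha G (?N v)"
            using v bz by (auto simp: S1_def L_def)
          ultimately show ?thesis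
            by auto
        qed
        then obtain A where A: "\<And>v. v \<in> S1 \<Longrightarrow> A v \<subseteq> ?N v \<and> indep (A v) ?E \<and> c \<le> card (A v)"
          by metis
        have "\<forall>v\<in>S1. finite (A v) \<and> indep (A v) ?E \<and> c \<le> card (A v) \<and> (\<forall>a\<in>A v. {v, a} \<in> ?E)"
        proof
          fix v assume v: "v \<in> S1"
          have "finite (A v)"
            using A[OF v] nbfin by (meson finite_subset)
          then show "finite (A v) \<and> indep (A v) ?E \<and> c \<le> card (A v) \<and> (\<forall>a\<in>A v. {v, a} \<in> ?E)"
            using A[OF v] by (auto simp: neighbours_def)
        qed
        from Nc[rule_format, OF free finS(1) ind(1) large this[rule_format]]
        obtain M f where M: "M \<subseteq> S1" "card M = Suc k"
          and f: "\<forall>v\<in>M. f v \<in> A v \<and> (\<forall>w\<in>M. v \<noteq> w \<longrightarrow> {v, f w} \<notin> ?E \<and> {f v, f w} \<notin> ?E)"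
          by auto
        \<comment> \<open>The matching touches the bag because its ends in \<open>M\<close> are
          vertices of \<open>S1\<close>.\<close>
        have "card M \<le> mu G (\<beta> z)"
          using simple
        proof (rule card_le_mu_pairing[where f = f])
          show "indep M ?E"
            using ind(1) M(1) by (rule smaller_indep)
          show "{v, f v} \<in> ?E" if "v \<in> M" for v
            using f that A[of v] M(1) by (auto simp: neighbours_def)
          show "{v, f w} \<notin> ?E \<and> {f v, f w} \<notin> ?E" if "v \<in> M" "w \<in> M" "v \<noteq> w" for v w
            using f that by blast
          show "M \<subseteq> \<beta> z \<or> f ` M \<subseteq> \<beta> z"
            using M(1) by (auto simp: S1_def)
        qed
        then show False
          using M(2) muz by simp
      qed
      \<comment> \<open>Shared by \<open>S2\<close> and \<open>S3\<close>. For \<open>S2\<close> the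
        dominating set is all of \<open>I\<close> and the dominated vertices lie in the bag; for
        \<open>S3\<close> it is \<open>\<beta> z \<inter> I\<close>, which itself lies in the
        bag.\<close>
      moreover have dominated: "card J \<le> c * k"
        if D: "D \<subseteq> I" and J: "finite J" "indep J ?E" "\<And>j. j \<in> J \<Longrightarrow> \<exists>d\<in>D. {d, j} \<in> ?E"
          and touch: "D \<subseteq> \<beta> z \<or> J \<subseteq> \<beta> z" for D J
      proof -
        have finD: "finite D"
          using D finI by (rule finite_subset)
        have deg: "card {j \<in> J. {d, j} \<in> ?E} \<le> c" if d: "d \<in> D" for d
        proof (rule less_imp_le, rule low)
          show "d \<in> L"
            using d D I(1) by auto
          show "{j \<in> J. {d, j} \<in> ?E} \<subseteq> ?N d"
            by (auto simp: neighbours_def)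
          show "indep {j \<in> J. {d, j} \<in> ?E} ?E"
            using J(2) by (rule smaller_indep) auto
        qed
        from private_neighbours[where E = ?E and c = c, OF finD J(1,3) deg]
        obtain M f where M: "M \<subseteq> D" "card J \<le> c * card M"
          and f: "\<forall>v\<in>M. f v \<in> J \<and> {v, f v} \<in> ?E \<and> (\<forall>w\<in>M. v \<noteq> w \<longrightarrow> {v, f w} \<notin> ?E)"
          by auto
        have "card M \<le> mu G (\<beta> z)"
          using simple
        proof (rule card_le_mu_pairing[where f = f])
          show "indep M ?E"
            using I(2) by (rule smaller_indep) (use M(1) D in auto)
          show "{v, f v} \<in> ?E" if "v \<in> M" for v
            using f that by blast
          show "M \<subseteq> \<beta> z \<or> f ` M \<subseteq> \<beta> z"
            using touch M(1) f by auto
          show "{v, f w} \<notin> ?E \<and> {f v, f w} \<notin> ?E" if vw: "v \<in> M" "w \<in> M" "v \<noteq> w" for v w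
          proof -
            \<comment> \<open>Privacy separates \<open>f v\<close> from \<open>f w\<close>, and
              independence of \<open>J\<close> then makes these two nonadjacent.\<close>
            have "{v, f v} \<in> ?E" "{v, f w} \<notin> ?E" "f v \<in> J" "f w \<in> J"
              using f vw by auto
            moreover from this have "f v \<noteq> f w"
              by auto
            ultimately show ?thesis
              using J(2) by (simp add: indep_def)
          qed
        qed
        then have "card M \<le> k"
          using muz by simp
        then have "c * card M \<le> c * k"
          by (rule mult_le_mono2)
        with M(2) show ?thesis
          by (rule order_trans)
      qed
      have "card S2 \<le> c * k"
        by (rule dominated[OF subset_refl finS(2) ind(2)]) (use dom in \<open>auto simp: S2_def\<close>)
      moreover have "card S3 \<le> c * k"
        by (rule dominated[of "\<beta> z \<inter> I", OF _ finS(3) ind(3)]) (auto simp: S3_def neighbours_def)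
      moreover have "S = S1 \<union> S2 \<union> S3"
        using S(1) I(1) by (auto simp: S1_def S2_def S3_def)
      moreover have "card (S1 \<union> S2 \<union> S3) \<le> card S1 + card S2 + card S3"
        using card_Un_le[of "S1 \<union> S2" S3] card_Un_le[of S1 S2] by linarith
      ultimately show ?thesis
        by simp
    qed
    \<comment> \<open>Fewer than \<open>c\<close> independent neighbours of the low vertex
      \<open>v\<close>, plus possibly \<open>v\<close> itself.\<close>
    have star: "card S \<le> c" if v: "v \<in> I" and S: "S \<subseteq> insert v (?N v)" "indep S ?E" for S v
    proof -
      have "card (S - {v}) < c"
        by (rule low[of v]) (use v S I(1) in \<open>auto intro: smaller_indep\<close>)
      moreover have "card S \<le> Suc (card (S - {v}))"
        by (auto simp: card_Diff_singleton_if)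
      ultimately show ?thesis
        by simp
    qed
    show ?thesis
      using dec'
    proof (rule tree_alpha_leI)
      fix x assume x: "x \<in> verts T'"
      have "finite (\<beta>' x)"
        using tree_decomposition_bag_subset[OF dec' x] fin by (rule finite_subset)
      then show "alpha G (\<beta>' x) \<le> N + c * k + c * k + c"
      proof (rule alpha_leI)
        fix S assume S: "S \<subseteq> \<beta>' x" "indep S ?E"
        from bags[OF x] show "card S \<le> N + c * k + c * k + c"
        proof (elim disjE bexE)
          fix z assume "z \<in> verts T" "\<beta>' x = \<beta> z - I \<union> (\<Union>v\<in>\<beta> z \<inter> I. ?N v)"
          then show ?thesis
            using swapped[of z S] S by simp
        next
          fix v assume "v \<in> I" "\<beta>' x = insert v (?N v)"
          then show ?thesis
            using star[of v S] S by simp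
        qed
      qed
    qed
  qed
  show ?thesis
    by (rule exI[of _ "N + c * k + c * k + c"], intro allI impI, erule (2) bound)
qed

section \<open>Hereditary classes and complete bipartite graphs\<close>

text \<open>The vertices outside \<open>X\<close> are deleted one at a time. As \<open>X\<close> is
  nonempty, the deleted vertex is never the last one.\<close>

lemma hereditary_induced_subgraph:
  assumes "graph_class \<G>" "hereditary \<G>" "G \<in> \<G>" "X \<subseteq> verts G" "X \<noteq> {}"
  shows "induced_subgraph G X \<in> \<G>"
  using assms(3,4)
proof (induction "card (verts G)" arbitrary: G rule: less_induct)
  case less
  have simple: "simple_graph G"
    using assms(1) less.prems by (simp add: graph_class_def)
  show ?case
  proof (cases "X = verts G")
    case True
    have "edges G \<subseteq> Pow (verts G)"
      using simple by (auto simp: simple_graph_def nsets_def)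
    then have "{e \<in> edges G. e \<subseteq> verts G} = edges G"
      by auto
    then have "induced_subgraph G X = G"
      by (simp add: induced_subgraph_def True)
    then show ?thesis
      using less.prems by simp
  next
    case False
    then obtain v where v: "v \<in> verts G" "v \<notin> X"
      using less.prems by auto
    have "verts G \<noteq> {v}"
      using v assms(5) less.prems by auto
    then have "del_vertex G v \<in> \<G>"
      using assms(2) less.prems v by (simp add: hereditary_def)
    moreover have "verts (del_vertex G v) = verts G - {v}"
      by (simp add: del_vertex_def induced_subgraph_def)
    moreover have "card (verts G - {v}) < card (verts G)"
      by (rule card_Diff1_less[OF simple_graph_finite[OF simple] v(1)])
    moreover have "X \<subseteq> verts G - {v}"
      using v less.prems by auto
    ultimately have "induced_subgraph (del_vertex G v) X \<in> \<G>"
      using less.hyps by simp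
    moreover have "{e \<in> {e \<in> edges G. e \<subseteq> verts G - {v}}. e \<subseteq> X} = {e \<in> edges G. e \<subseteq> X}"
      using \<open>X \<subseteq> verts G - {v}\<close> by auto
    then have "induced_subgraph (del_vertex G v) X = induced_subgraph G X"
      by (simp add: induced_subgraph_def del_vertex_def)
    ultimately show ?thesis
      by simp
  qed
qed

text \<open>An induced biclique with both sides as large as the larger side of \<open>H\<close>
  contains a copy of \<open>H\<close>, so closure under induced subgraphs and isomorphism would put
  \<open>H\<close> into the class.\<close>

lemma hereditary_biclique_free:
  assumes "graph_class \<G>" "hereditary \<G>" "complete_bipartite H" "H \<notin> \<G>"
  shows "\<exists>n>0. \<forall>G\<in>\<G>. biclique_free n (edges G)"
proof -
  obtain A0 B0 where AB0: "A0 \<noteq> {}" "B0 \<noteq> {}" "A0 \<inter> B0 = {}" "verts H = A0 \<union> B0"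
    "edges H = {{a, b} |a b. a \<in> A0 \<and> b \<in> B0}" and H: "simple_graph H"
    using assms(3) unfolding complete_bipartite_def by (elim conjE exE) (rule that)
  have fin0: "finite A0" "finite B0"
    using simple_graph_finite[OF H] AB0(4) by auto
  define n where "n = max (card A0) (card B0)"
  have "0 < n"
    using fin0 AB0(1) by (simp add: n_def card_gt_0_iff less_max_iff_disj)
  moreover have "biclique_free n (edges G)" if G: "G \<in> \<G>" for G
  proof (rule ccontr)
    assume "\<not> ?thesis"
    then obtain A B where AB: "card A = n" "card B = n" "indep A (edges G)" "indep B (edges G)"
      and edges: "\<And>a b. a \<in> A \<Longrightarrow> b \<in> B \<Longrightarrow> {a, b} \<in> edges G"
      unfolding biclique_free_def by auto
    have simple: "simple_graph G"
      using assms(1) G by (simp add: graph_class_def)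
    obtain A1 where A1: "A1 \<subseteq> A" "card A1 = card A0" "finite A1"
      using obtain_subset_with_card_n[of "card A0" A] AB(1) by (auto simp: n_def)
    obtain B1 where B1: "B1 \<subseteq> B" "card B1 = card B0" "finite B1"
      using obtain_subset_with_card_n[of "card B0" B] AB(2) by (auto simp: n_def)
    have ne: "A1 \<noteq> {}" "B1 \<noteq> {}"
      using A1 B1 AB0 fin0 by auto
    \<comment> \<open>A common vertex would be adjacent to itself.\<close>
    have disj: "A1 \<inter> B1 = {}"
      using edges A1(1) B1(1) simple_graph_edgeD(3)[OF simple] by blast
    have "a \<in> verts G \<and> b \<in> verts G" if "a \<in> A1" "b \<in> B1" for a b
      using simple_graph_edgeD[OF simple edges[of a b]] that A1(1) B1(1) by auto
    then have sub: "A1 \<union> B1 \<subseteq> verts G"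
      using ne by auto
    let ?K = "induced_subgraph G (A1 \<union> B1)"
    have K: "?K \<in> \<G>"
      by (rule hereditary_induced_subgraph[OF assms(1,2) G sub]) (use ne in auto)
    obtain f where f: "bij_betw f A1 A0"
      using finite_same_card_bij[OF A1(3) fin0(1) A1(2)] ..
    obtain g where g: "bij_betw g B1 B0"
      using finite_same_card_bij[OF B1(3) fin0(2) B1(2)] ..
    \<comment> \<open>Bijections of the two sides glue to an isomorphism, since adjacency depends
      only on the sides of the two vertices.\<close>
    define h where "h x = (if x \<in> A1 then f x else g x)" for x
    have bij: "bij_betw h (A1 \<union> B1) (A0 \<union> B0)"
      unfolding h_def using f g disj AB0(3) by (rule bij_betw_disjoint_Un)
    have hA: "h x \<in> A0" if "x \<in> A1" for x
      using bij_betwE[OF f] that by (auto simp: h_def)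
    have hB: "h x \<in> B0" if "x \<in> B1" for x
      using bij_betwE[OF g] that disj by (auto simp: h_def)
    have no: "{u, v} \<notin> edges G" if "u \<in> A1 \<and> v \<in> A1 \<or> u \<in> B1 \<and> v \<in> B1" for u v
    proof -
      have "u \<in> A \<and> v \<in> A \<or> u \<in> B \<and> v \<in> B"
        using that A1(1) B1(1) by blast
      then show ?thesis
        using AB(3,4) simple_graph_edgeD(3)[OF simple, of u v] unfolding indep_def by blast
    qed
    have "{u, v} \<in> edges ?K \<longleftrightarrow> {h u, h v} \<in> edges H" if uv: "u \<in> A1 \<union> B1" "v \<in> A1 \<union> B1" for u v
    proof -
      have K: "{u, v} \<in> edges ?K \<longleftrightarrow> {u, v} \<in> edges G"
        using uv by (simp add: induced_subgraph_def)
      have Hedge: "{x, y} \<in> edges H \<longleftrightarrow> x \<in> A0 \<and> y \<in> B0 \<or> x \<in> B0 \<and> y \<in> A0" for x y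
        unfolding AB0(5) by (auto simp: doubleton_eq_iff)
      from uv consider "u \<in> A1 \<and> v \<in> A1 \<or> u \<in> B1 \<and> v \<in> B1" | "u \<in> A1" "v \<in> B1" | "u \<in> B1" "v \<in> A1"
        by blast
      then show ?thesis
      proof cases
        case 1
        then have "h u \<in> A0 \<and> h v \<in> A0 \<or> h u \<in> B0 \<and> h v \<in> B0"
          using hA hB by blast
        then show ?thesis
          using no[OF 1] AB0(3) unfolding K Hedge by blast
      next
        case 2
        then have "{u, v} \<in> edges G"
          using edges A1(1) B1(1) by blast
        then show ?thesis
          using hA hB 2 unfolding K Hedge by blast
      next
        case 3
        then have "{v, u} \<in> edges G"
          using edges A1(1) B1(1) by blast
        then show ?thesis
          using hA hB 3 unfolding K Hedge by (simp add: insert_commute)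
      qed
    qed
    then have "graph_iso ?K H"
      unfolding graph_iso_def using bij AB0(4)
      by (intro exI[of _ h]) (simp add: induced_subgraph_def)
    then have "H \<in> \<G>"
      using assms(1) K H unfolding graph_class_def by blast
    then show False
      using assms(4) by simp
  qed
  ultimately show ?thesis
    by blast
qed

text \<open>\<open>K_{n,n}\<close> works: any two of its edges are joined by an edge, so induced
  matchings have at most one edge, whereas some bag of every tree decomposition contains a whole
  side, which is independent of size \<open>n\<close>.\<close>

lemma exists_complete_bipartite:
  assumes "0 < n"
  shows "\<exists>G :: 'a::infinite ugraph. complete_bipartite G \<and> tree_mu G \<le> 1 \<and> n \<le> tree_alpha G"
proof -
  obtain Z :: "'a set" where Z: "finite Z" "card Z = n + n"
    using infinite_arbitrarily_large[OF infinite_UNIV, of "n + n"] by auto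
  then obtain A where A: "A \<subseteq> Z" "card A = n" "finite A"
    using obtain_subset_with_card_n[of n Z] by auto
  define B where "B = Z - A"
  have B: "card B = n" "finite B" "A \<inter> B = {}"
    using A Z by (auto simp: B_def card_Diff_subset)
  define G where "G = \<lparr>verts = A \<union> B, edges = {{a, b} |a b. a \<in> A \<and> b \<in> B}\<rparr>"
  have G: "verts G = A \<union> B" "edges G = {{a, b} |a b. a \<in> A \<and> b \<in> B}"
    by (simp_all add: G_def)
  have ne: "A \<noteq> {}" "B \<noteq> {}"
    using A B assms by auto
  have simple: "simple_graph G"
    using A B ne by (auto simp: simple_graph_def G)
  have "complete_bipartite G"
    unfolding complete_bipartite_def using simple ne B(3) G by blast
  moreover have "tree_mu G \<le> 1"
  proof (rule tree_mu_leI[OF single_bag_tree_decomposition[OF simple]], rule mu_leI[OF simple])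
    fix M assume M: "induced_matching G M"
    have "e = e'" if e: "e \<in> M" "e' \<in> M" for e e'
    proof (rule ccontr)
      assume "e \<noteq> e'"
      have "e \<in> edges G" "e' \<in> edges G"
        using M e by (auto simp: induced_matching_def)
      \<comment> \<open>The \<open>A\<close>-end of one edge and the \<open>B\<close>-end of the
        other are adjacent.\<close>
      then have "(\<exists>a b. e = {a, b} \<and> a \<in> A) \<and> (\<exists>a b. e' = {a, b} \<and> b \<in> B)"
        unfolding G by auto
      then obtain a b a' b' where ab: "e = {a, b}" "e' = {a', b'}" "a \<in> A" "b' \<in> B"
        by (elim conjE exE) (rule that)
      have "\<forall>u\<in>e. \<forall>v\<in>e'. {u, v} \<notin> edges G"
        using M e \<open>e \<noteq> e'\<close> unfolding induced_matching_def by simp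
      then have "{a, b'} \<notin> edges G"
        using ab by simp
      then show False
        using ab unfolding G by blast
    qed
    then show "card M \<le> 1"
      by (cases "finite M") (auto simp: card_le_Suc0_iff_eq)
  qed
  moreover have "n \<le> tree_alpha G"
  proof -
    obtain T \<beta> where T: "tree_decomposition G T \<beta>" "\<forall>x\<in>verts T. alpha G (\<beta> x) \<le> tree_alpha G"
      using simple by (rule tree_alpha_attained)
    obtain x where x: "x \<in> verts T" "A \<subseteq> \<beta> x \<or> B \<subseteq> \<beta> x"
      using tree_decomposition_biclique[OF T(1) G(1)] unfolding G(2) by blast
    have fin: "finite (\<beta> x)"
      using tree_decomposition_bag_subset[OF T(1) x(1)] simple_graph_finite[OF simple] by (rule finite_subset)
    have "indep A (edges G)" "indep B (edges G)"
      using B(3) unfolding G indep_def by (auto simp: doubleton_eq_iff)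
    then have "n \<le> alpha G (\<beta> x)"
      using x(2) card_le_alpha[OF fin, of A G] card_le_alpha[OF fin, of B G] A B by auto
    then show ?thesis
      using T(2) x(1) by force
  qed
  ultimately show ?thesis
    by blast
qed

section \<open>Functional equivalence in hereditary classes\<close>

theorem corollary1p2:
  fixes \<G> :: "('a::infinite) ugraph set"
  assumes "graph_class \<G>" and "hereditary \<G>"
  shows "functionally_equivalent tree_alpha tree_mu \<G> \<longleftrightarrow>
         \<not> (\<forall>G. complete_bipartite G \<longrightarrow> G \<in> \<G>)"
proof
  assume "functionally_equivalent tree_alpha tree_mu \<G>"
  then obtain f where f: "\<And>G. G \<in> \<G> \<Longrightarrow> tree_alpha G \<le> f (tree_mu G)"
    unfolding functionally_equivalent_def by blast
  show "\<not> (\<forall>G. complete_bipartite G \<longrightarrow> G \<in> \<G>)"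
  proof
    assume all: "\<forall>G. complete_bipartite G \<longrightarrow> G \<in> \<G>"
    \<comment> \<open>\<open>f\<close> may fail to be monotone, and \<open>tree_mu G \<le> 1\<close>
      allows the values 0 and 1, so \<open>tree_alpha G\<close> has to exceed both
      \<open>f 0\<close> and \<open>f 1\<close>.\<close>
    obtain G :: "'a ugraph" where G: "complete_bipartite G" "tree_mu G \<le> 1"
      "Suc (max (f 0) (f 1)) \<le> tree_alpha G"
      using exists_complete_bipartite[of "Suc (max (f 0) (f 1))"] by auto
    have "tree_alpha G \<le> f (tree_mu G)"
      using f all G(1) by blast
    moreover have "tree_mu G = 0 \<or> tree_mu G = 1"
      using G(2) by linarith
    ultimately show False
      using G(3) by auto
  qed
next
  assume "\<not> (\<forall>G. complete_bipartite G \<longrightarrow> G \<in> \<G>)"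
  then obtain H where "complete_bipartite H" "H \<notin> \<G>"
    by blast
  then obtain n where n: "0 < n" "\<And>G. G \<in> \<G> \<Longrightarrow> biclique_free n (edges G)"
    using hereditary_biclique_free[OF assms] by blast
  have simple: "simple_graph G" if "G \<in> \<G>" for G
    using assms(1) that by (simp add: graph_class_def)
  \<comment> \<open>The bound for fixed \<open>k\<close> is uniform over all graphs, so choosing one
    constant for each \<open>k\<close> yields the bounding function.\<close>
  have "\<exists>f. \<forall>k. \<forall>G :: 'a ugraph. simple_graph G \<longrightarrow> biclique_free n (edges G) \<longrightarrow> tree_mu G \<le> k \<longrightarrow> tree_alpha G \<le> f k"
    using tree_alpha_bounded_by_tree_mu[OF n(1)] by (intro choice allI)
  then obtain f where f: "\<And>k G. simple_graph (G :: 'a ugraph) \<Longrightarrow> biclique_free n (edges G) \<Longrightarrow>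
      tree_mu G \<le> k \<Longrightarrow> tree_alpha G \<le> f k"
    by blast
  have "tree_alpha G \<le> f (tree_mu G) \<and> tree_mu G \<le> id (tree_alpha G)" if "G \<in> \<G>" for G
    using f[OF simple[OF that] n(2)[OF that] order_refl] tree_mu_le_tree_alpha[OF simple[OF that]]
    by simp
  then show "functionally_equivalent tree_alpha tree_mu \<G>"
    unfolding functionally_equivalent_def by blast
qed

end
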